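(* Let $K$ be a field. Given a positive integer $n$ and a sequence $(b_i)_{0<i<n}$ of non-negative integers, there exists an indecomposable $n$D persistence module over $K$ with finite support whose support has $i$-th Betti number equal to $b_i$ for every $0<i<n$.
   Context: $\mathrm{vect}_K$ is the category of finite-dimensional $K$-vector spaces. $\mathbb{Z}^{n}$ carries the componentwise order, viewed as a category. An $n$D persistence module is a functor $M:(\mathbb{Z}^{n},\le)\to\mathrm{vect}_K$; direct sums are pointwise. $M$ is indecomposable if $M\ne0$ and $M\cong W\oplus W'$ implies $W=0$ or $W'=0$. The support of $M$ is $\{x\in\mathbb{Z}^n: M(x)\neq0\}$. The clique cubical complex of the support is the cubical complex consisting of all elementary unit cubes of the grid $\mathbb{Z}^n$ (of all dimensions $0,\dots,n$) all of whose vertices lie in the support. The $i$-th Betti number of the support is the dimension of the $i$-dimensional homology (with coefficients in $K$) of this complex. *)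

theory Defs
  imports "HOL.Vector_Spaces" "HOL-Library.Poly_Mapping" "HOL-Library.Product_Plus"
begin

section \<open>Vector spaces\<close>

text \<open>
  The type \<open>'i \<Rightarrow>\<^sub>0 'k\<close> of finitely supported functions is the free \<open>'k\<close>-vector space on
  \<open>'i\<close>. It serves for cubical chains and, with \<open>'i = nat\<close>, as an ambient space of which every
  finite-dimensional \<open>'k\<close>-vector space is, up to isomorphism, a subspace.
\<close>

definition pscale :: "'k::field \<Rightarrow> ('i \<Rightarrow>\<^sub>0 'k) \<Rightarrow> ('i \<Rightarrow>\<^sub>0 'k)" where
  "pscale c p = Poly_Mapping.map ((*) c) p"

lemma lookup_pscale [simp]: "Poly_Mapping.lookup (pscale c p) i = c * Poly_Mapping.lookup p i"
  by (cases "Poly_Mapping.lookup p i = 0") (simp_all add: pscale_def Poly_Mapping.map.rep_eq)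

lemma vector_space_pscale: "vector_space (pscale :: 'k::field \<Rightarrow> ('i \<Rightarrow>\<^sub>0 'k) \<Rightarrow> _)"
  by standard (simp_all add: poly_mapping_eq_iff fun_eq_iff lookup_add algebra_simps)

definition prod_scale :: "('k \<Rightarrow> 'v \<Rightarrow> 'v) \<Rightarrow> ('k \<Rightarrow> 'w \<Rightarrow> 'w) \<Rightarrow> 'k \<Rightarrow> 'v \<times> 'w \<Rightarrow> 'v \<times> 'w" where
  "prod_scale s t c = map_prod (s c) (t c)"

lemma vector_space_prod_scale:
  assumes "vector_space s" "vector_space t"
  shows "vector_space (prod_scale s t)"
proof -
  interpret S: vector_space s by fact
  interpret T: vector_space t by fact
  show ?thesis
    by standard
      (auto simp: prod_scale_def plus_prod_def S.scale_right_distrib T.scale_right_distrib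
        S.scale_left_distrib T.scale_left_distrib)
qed

definition linear_on ::
  "('k \<Rightarrow> 'v::ab_group_add \<Rightarrow> 'v) \<Rightarrow> ('k \<Rightarrow> 'w::ab_group_add \<Rightarrow> 'w) \<Rightarrow> 'v set \<Rightarrow> ('v \<Rightarrow> 'w) \<Rightarrow> bool"
  where
  "linear_on s t V f \<longleftrightarrow>
     (\<forall>u\<in>V. \<forall>v\<in>V. f (u + v) = f u + f v) \<and> (\<forall>c. \<forall>v\<in>V. f (s c v) = t c (f v))"

text \<open>
  For subspaces \<open>B \<subseteq> Z\<close>: the cosets \<open>s + B\<close>, \<open>s \<in> S\<close>, are pairwise distinct and form a (finite)
  basis of the quotient space \<open>Z / B\<close>.
\<close>

definition quotient_basis ::
  "('k::field \<Rightarrow> 'v::ab_group_add \<Rightarrow> 'v) \<Rightarrow> 'v set \<Rightarrow> 'v set \<Rightarrow> 'v set \<Rightarrow> bool" where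
  "quotient_basis scale Z B S \<longleftrightarrow>
     finite S \<and> S \<subseteq> Z \<and>
     (\<forall>z\<in>Z. \<exists>c. z - (\<Sum>s\<in>S. scale (c s) s) \<in> B) \<and>
     (\<forall>c. (\<Sum>s\<in>S. scale (c s) s) \<in> B \<longrightarrow> (\<forall>s\<in>S. c s = 0))"

text \<open>As for \<^const>\<open>vector_space.dim\<close>, an infinite dimension is represented by \<open>0\<close>.\<close>

definition quotient_dim ::
  "('k::field \<Rightarrow> 'v::ab_group_add \<Rightarrow> 'v) \<Rightarrow> 'v set \<Rightarrow> 'v set \<Rightarrow> nat" where
  "quotient_dim scale Z B =
     (if \<exists>S. quotient_basis scale Z B S then card (SOME S. quotient_basis scale Z B S) else 0)"


section \<open>Persistence modules\<close>

text \<open>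
  The poset \<open>\<int>\<^sup>n\<close>: coordinates are indexed by \<open>0, \<dots>, n - 1\<close> and padded with \<open>0\<close>, so that the
  pointwise order of functions restricts to the componentwise order.
\<close>

type_synonym point = "nat \<Rightarrow> int"

definition grid :: "nat \<Rightarrow> point set" where
  "grid n = {x. \<forall>k\<ge>n. x k = 0}"

record 'v pmod =
  pspace :: "point \<Rightarrow> 'v set"
  ptrans :: "point \<Rightarrow> point \<Rightarrow> 'v \<Rightarrow> 'v"

text \<open>
  Functors from \<open>grid n\<close> to finite-dimensional vector spaces, realised as subspaces of the ambient
  space \<open>'v\<close>. Only the values of \<open>pspace\<close> on \<open>grid n\<close>, and of \<open>ptrans x y\<close> for \<open>x \<le> y\<close> in \<open>grid n\<close>
  and on \<open>pspace M x\<close>, are relevant.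
\<close>

definition persistence_module ::
  "('k::field \<Rightarrow> 'v::ab_group_add \<Rightarrow> 'v) \<Rightarrow> nat \<Rightarrow> 'v pmod \<Rightarrow> bool" where
  "persistence_module scale n M \<longleftrightarrow>
     (\<forall>x\<in>grid n. \<exists>B. finite B \<and> pspace M x = module.span scale B) \<and>
     (\<forall>x\<in>grid n. \<forall>y\<in>grid n. x \<le> y \<longrightarrow>
        ptrans M x y ` pspace M x \<subseteq> pspace M y \<and> linear_on scale scale (pspace M x) (ptrans M x y)) \<and>
     (\<forall>x\<in>grid n. \<forall>v\<in>pspace M x. ptrans M x x v = v) \<and>
     (\<forall>x\<in>grid n. \<forall>y\<in>grid n. \<forall>z\<in>grid n. x \<le> y \<longrightarrow> y \<le> z \<longrightarrow>
        (\<forall>v\<in>pspace M x. ptrans M y z (ptrans M x y v) = ptrans M x z v))"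

definition pmod_zero :: "nat \<Rightarrow> 'v::zero pmod \<Rightarrow> bool" where
  "pmod_zero n M \<longleftrightarrow> (\<forall>x\<in>grid n. pspace M x = {0})"

definition pmod_sum :: "'v pmod \<Rightarrow> 'w pmod \<Rightarrow> ('v \<times> 'w) pmod" where
  "pmod_sum M N =
     \<lparr> pspace = (\<lambda>x. pspace M x \<times> pspace N x),
       ptrans = (\<lambda>x y. map_prod (ptrans M x y) (ptrans N x y)) \<rparr>"

definition pmod_iso ::
  "('k::field \<Rightarrow> 'v::ab_group_add \<Rightarrow> 'v) \<Rightarrow> ('k \<Rightarrow> 'w::ab_group_add \<Rightarrow> 'w) \<Rightarrow> nat \<Rightarrow>
    'v pmod \<Rightarrow> 'w pmod \<Rightarrow> bool" where
  "pmod_iso s t n M N \<longleftrightarrow>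
     (\<exists>\<phi>. (\<forall>x\<in>grid n. linear_on s t (pspace M x) (\<phi> x) \<and> bij_betw (\<phi> x) (pspace M x) (pspace N x)) \<and>
          (\<forall>x\<in>grid n. \<forall>y\<in>grid n. x \<le> y \<longrightarrow>
             (\<forall>v\<in>pspace M x. \<phi> y (ptrans M x y v) = ptrans N x y (\<phi> x v))))"

text \<open>
  It is no restriction that the summands live in the same ambient space as \<open>M\<close>: if \<open>M\<close> is
  isomorphic to \<open>W \<oplus> W'\<close>, each \<open>W x\<close> is isomorphic to a subspace of \<open>M x\<close>.
\<close>

definition pmod_indecomposable ::
  "('k::field \<Rightarrow> 'v::ab_group_add \<Rightarrow> 'v) \<Rightarrow> nat \<Rightarrow> 'v pmod \<Rightarrow> bool" where
  "pmod_indecomposable scale n M \<longleftrightarrow>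
     \<not> pmod_zero n M \<and>
     (\<forall>W W' :: 'v pmod.
        persistence_module scale n W \<longrightarrow> persistence_module scale n W' \<longrightarrow>
        pmod_iso scale (prod_scale scale scale) n M (pmod_sum W W') \<longrightarrow>
        pmod_zero n W \<or> pmod_zero n W')"

definition pmod_support :: "nat \<Rightarrow> 'v::zero pmod \<Rightarrow> point set" where
  "pmod_support n M = {x\<in>grid n. pspace M x \<noteq> {0}}"


section \<open>Homology of the clique cubical complex\<close>

text \<open>
  The pair \<open>(a, J)\<close> is the elementary cube with least vertex \<open>a\<close> that is the product of the
  intervals \<open>[a k, a k + 1]\<close> for \<open>k \<in> J\<close> and the points \<open>a k\<close> for \<open>k \<notin> J\<close>.
\<close>

type_synonym cube = "point \<times> nat set"

definition vertices :: "cube \<Rightarrow> point set" where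
  "vertices = (\<lambda>(a, J). {x. \<forall>k. if k \<in> J then x k \<in> {a k, a k + 1} else x k = a k})"

definition cubes :: "nat \<Rightarrow> point set \<Rightarrow> nat \<Rightarrow> cube set" where
  "cubes n X i = {(a, J). a \<in> grid n \<and> J \<subseteq> {..<n} \<and> card J = i \<and> vertices (a, J) \<subseteq> X}"

definition cube_boundary :: "cube \<Rightarrow> cube \<Rightarrow>\<^sub>0 'k::field" where
  "cube_boundary = (\<lambda>(a, J). \<Sum>j\<in>J. pscale ((-1) ^ card {k\<in>J. k < j})
     (Poly_Mapping.single (a(j := a j + 1), J - {j}) 1 - Poly_Mapping.single (a, J - {j}) 1))"

definition chains :: "nat \<Rightarrow> point set \<Rightarrow> nat \<Rightarrow> (cube \<Rightarrow>\<^sub>0 'k::field) set" where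
  "chains n X i = {z. Poly_Mapping.keys z \<subseteq> cubes n X i}"

definition boundary :: "(cube \<Rightarrow>\<^sub>0 'k::field) \<Rightarrow> (cube \<Rightarrow>\<^sub>0 'k)" where
  "boundary z = (\<Sum>q\<in>Poly_Mapping.keys z. pscale (Poly_Mapping.lookup z q) (cube_boundary q))"

definition cycles :: "nat \<Rightarrow> point set \<Rightarrow> nat \<Rightarrow> (cube \<Rightarrow>\<^sub>0 'k::field) set" where
  "cycles n X i = {z\<in>chains n X i. boundary z = 0}"

definition boundaries :: "nat \<Rightarrow> point set \<Rightarrow> nat \<Rightarrow> (cube \<Rightarrow>\<^sub>0 'k::field) set" where
  "boundaries n X i = boundary ` chains n X (Suc i)"

definition betti :: "'k::field itself \<Rightarrow> nat \<Rightarrow> point set \<Rightarrow> nat \<Rightarrow> nat" where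
  "betti _ n X i = quotient_dim pscale (cycles n X i :: (cube \<Rightarrow>\<^sub>0 'k) set) (boundaries n X i)"

end

theory Submission
  imports Defs
begin

text \<open>
  The module. Cover a finite set \<open>X\<close> by intervals \<open>P\<^sub>i\<close> of the grid, each with a least element \<open>p\<^sub>i\<close> that lies
  in no other \<open>P\<^sub>j\<close>, and let \<open>G \<subseteq> X\<close> consist of points that are maximal in all intervals containing them.
  Take the direct sum of the interval modules of the \<open>P\<^sub>i\<close> and, at every \<open>g \<in> G\<close>, identify all copies of
  \<open>K\<close> with one another; maximality makes this a quotient module. It is generated by the one-dimensional
  spaces at the points \<open>p\<^sub>i\<close>, so an idempotent endomorphism acts on the \<open>i\<close>-th generator by \<open>0\<close> or \<open>1\<close>,
  and by the same scalar on two generators that meet at a point of \<open>G\<close>. If all intervals meet a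
  common one inside \<open>G\<close>, the module is therefore indecomposable, and its support is \<open>X\<close>.

  The support. Start with a cubically contractible set \<open>Y\<close>, essentially a box that is long in the
  direction \<open>0\<close>, and remove for every \<open>i\<close> with \<open>0 < i < n\<close> exactly \<open>b\<^sub>i\<close> slabs that are points in \<open>i + 1\<close>
  directions and go through all of \<open>Y\<close> in the other directions. Each of them contributes an \<open>i\<close>-sphere.
  The set \<open>Y\<close> has thin tentacles (which do not affect its homotopy type): these give the intervals
  covering the complement of the slabs pairwise incomparable least elements and common maxima.
\<close>

text \<open>Homology is computed from a pair. Since \<open>Y\<close> has no homology in positive
  degrees, the \<open>i\<close>-th homology of \<open>X\<close> is the relative homology of
  \<open>(Y, X)\<close> in degree \<open>i + 1\<close>, and relative chains split over the holes as
  soon as no cube touches two of them. This is why the holes sit at the odd positions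
  \<open>2 * j + 1\<close> of direction \<open>0\<close>. Over a hole that is a point in
  \<open>i + 1\<close> directions, the relative homology is spanned by one disc of dimension
  \<open>i + 1\<close> transverse to it.

  The difficulty is to reconcile shape and order. Gluing needs common points that are maximal,
  whereas the generators stay apart only if no least element lies in another interval. Directions
  \<open>0\<close> and \<open>1\<close> provide the room for both: the least elements of the
  intervals between holes slide down the antidiagonal \<open>x 0 + x 1 = -1\<close>, and every
  interval reaches the antidiagonal \<open>x 0 + x 1 = 2 * m + 1\<close>, beyond which the support
  does not go. Identifications at maximal points shrink spaces but never to zero, so the support
  stays the union of the intervals.\<close>

abbreviation "coeff \<equiv> Poly_Mapping.lookup"
abbreviation "single \<equiv> Poly_Mapping.single"
abbreviation "keys \<equiv> Poly_Mapping.keys"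

section \<open>Cubical chains\<close>

interpretation pscale: vector_space pscale
  by (rule vector_space_pscale)

section \<open>Well-definedness of the dimension of a quotient\<close>

lemma card_quotient_basis_le:
  assumes "vector_space scale" "module.subspace scale B"
    and S: "quotient_basis scale Z B S" and S': "quotient_basis scale Z B S'"
  shows "card S' \<le> card S"
proof -
  interpret vector_space scale by fact
  have fin: "finite S" "finite S'" using S S' by (auto simp: quotient_basis_def)
  have "\<forall>s\<in>S'. \<exists>c. s - (\<Sum>t\<in>S. scale (c t) t) \<in> B"
    using S S' unfolding quotient_basis_def by blast
  then obtain c where c: "\<And>s. s \<in> S' \<Longrightarrow> s - (\<Sum>t\<in>S. scale (c s t) t) \<in> B" by metis
  \<comment> \<open>The coordinates of \<open>s\<close> modulo \<open>B\<close> with respect to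
    \<open>S\<close>, as a vector of the free space on \<open>S\<close>. The vectors
    \<open>r s\<close> turn out to be independent, so the exchange bound in that free space compares
    the two cardinalities without forming the quotient.\<close>
  define r where "r s = (\<Sum>t\<in>S. single t (c s t))" for s
  have r: "coeff (r s) t = (if t \<in> S then c s t else 0)" for s t
    using fin by (auto simp: r_def lookup_sum lookup_single when_def)
  have triv: "\<forall>s\<in>S'. g s = 0" if g: "(\<Sum>s\<in>S'. pscale (g s) (r s)) = 0" for g
  proof -
    have g0: "(\<Sum>s\<in>S'. g s * c s t) = 0" if "t \<in> S" for t
      using arg_cong[OF g, of "\<lambda>p. coeff p t"] that by (simp add: lookup_sum r)
    have "(\<Sum>s\<in>S'. scale (g s) (s - (\<Sum>t\<in>S. scale (c s t) t))) \<in> B"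
      by (intro subspace_sum subspace_scale c assms)
    also have "(\<Sum>s\<in>S'. scale (g s) (s - (\<Sum>t\<in>S. scale (c s t) t))) =
        (\<Sum>s\<in>S'. scale (g s) s) - (\<Sum>s\<in>S'. \<Sum>t\<in>S. scale (g s * c s t) t)"
      by (simp add: scale_right_diff_distrib sum_subtractf scale_sum_right)
    also have "(\<Sum>s\<in>S'. \<Sum>t\<in>S. scale (g s * c s t) t) = (\<Sum>t\<in>S. scale (\<Sum>s\<in>S'. g s * c s t) t)"
      by (subst sum.swap) (simp add: scale_sum_left)
    also have "\<dots> = 0" using g0 by simp
    finally show ?thesis using S' by (simp add: quotient_basis_def)
  qed
  have inj: "inj_on r S'"
  proof (rule inj_onI, rule ccontr)
    fix s s' assume s: "s \<in> S'" "s' \<in> S'" "r s = r s'" "s \<noteq> s'"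
    let ?g = "\<lambda>u. (if u = s then 1 else 0) - (if u = s' then 1 else 0)"
    have "(\<Sum>u\<in>S'. pscale (?g u) (r u)) = 0"
      using s fin by (simp add: pscale.scale_left_diff_distrib sum_subtractf if_distrib[of "\<lambda>x.
          pscale x _"] cong: if_cong)
    from triv[OF this] s show False by (auto split: if_splits)
  qed
  have "pscale.independent (r ` S')"
    using fin triv[of "\<lambda>s. _ (r s)"] by (auto simp: pscale.dependent_finite sum.reindex[OF inj])
  moreover have "r ` S' \<subseteq> pscale.span ((\<lambda>t. single t 1) ` S)"
  proof (intro subsetI, elim imageE, simp only:)
    fix s
    have "pscale (c s t) (single t 1) = single t (c s t)" for t
      by (intro poly_mapping_eqI) (auto simp: lookup_single when_def)
    then have "r s = (\<Sum>t\<in>S. pscale (c s t) (single t 1))"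
      by (simp add: r_def)
    also have "\<dots> \<in> pscale.span ((\<lambda>t. single t 1) ` S)"
      by (intro pscale.span_sum pscale.span_scale pscale.span_base) auto
    finally show "r s \<in> pscale.span ((\<lambda>t. single t 1) ` S)" .
  qed
  ultimately have "card (r ` S') \<le> card ((\<lambda>t. single t (1::'a)) ` S)"
    using pscale.independent_span_bound fin by blast
  also have "\<dots> \<le> card S" using fin by (simp add: card_image_le)
  finally show ?thesis by (simp add: card_image[OF inj])
qed

lemma quotient_dim_eq_card:
  assumes "vector_space scale" "module.subspace scale B" "quotient_basis scale Z B S"
  shows "quotient_dim scale Z B = card S"
proof -
  have some: "quotient_basis scale Z B (SOME S. quotient_basis scale Z B S)"
    using assms(3) by (rule someI)
  have "card (SOME S. quotient_basis scale Z B S) = card S"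
    using card_quotient_basis_le[OF assms(1,2) some assms(3)]
      card_quotient_basis_le[OF assms(1,2) assms(3) some] by (rule antisym[rotated])
  with assms(3) show ?thesis
    unfolding quotient_dim_def by (metis (no_types))
qed

section \<open>Signs and the boundary operator\<close>

definition bsign :: "nat \<Rightarrow> nat set \<Rightarrow> 'k::field" where
  "bsign k K = (-1) ^ card {i\<in>K. i < k}"

lemma bsign_square [simp]: "bsign k K * bsign k K = 1" "bsign k K * (bsign k K * x) = x"
  by (simp_all add: bsign_def flip: power_add mult.assoc)

lemma bsign_insert_self [simp]: "bsign k (insert k K) = bsign k K"
proof -
  have "{i \<in> insert k K. i < k} = {i \<in> K. i < k}" by auto
  then show ?thesis by (simp add: bsign_def)
qed

lemma bsign_remove_self [simp]: "bsign k (K - {k}) = bsign k K"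
proof -
  have "{i \<in> K - {k}. i < k} = {i \<in> K. i < k}" by auto
  then show ?thesis by (simp add: bsign_def)
qed

lemma bsign_insert:
  assumes "finite K" "l \<notin> K"
  shows "bsign k (insert l K) = (if l < k then - bsign k K else bsign k K)"
proof -
  have "{i \<in> insert l K. i < k} = (if l < k then insert l {i \<in> K. i < k} else {i \<in> K. i < k})"
    by auto
  then show ?thesis using assms by (simp add: bsign_def)
qed

lemma bsign_anticommute:
  assumes "finite K" "k \<notin> K" "l \<notin> K" "k \<noteq> l"
  shows "bsign k K * bsign l (insert k K) = - (bsign l K * bsign k (insert l K))"
  using assms by (auto simp: bsign_insert)

lemma boundary_eq_sum:
  assumes "finite F" "keys z \<subseteq> F"
  shows "boundary z = (\<Sum>q\<in>F. pscale (coeff z q) (cube_boundary q))"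
  unfolding boundary_def
  by (rule sum.mono_neutral_left) (use assms in \<open>auto simp: in_keys_iff\<close>)

lemma boundary_zero [simp]: "boundary 0 = 0"
  by (simp add: boundary_def)

lemma boundary_add: "boundary (y + z) = boundary y + boundary z"
proof -
  let ?F = "keys y \<union> keys z"
  have "keys (y + z) \<subseteq> ?F" by (rule keys_add)
  then show ?thesis
    by (simp add: boundary_eq_sum[of ?F] lookup_add pscale.scale_left_distrib sum.distrib)
qed

lemma boundary_pscale: "boundary (pscale c z) = pscale c (boundary z)"
proof -
  have "keys (pscale c z) \<subseteq> keys z" by (auto simp: in_keys_iff)
  then show ?thesis
    by (simp add: boundary_eq_sum[of "keys z"] pscale.scale_sum_right)
qed

lemma boundary_diff: "boundary (y - z) = boundary y - boundary z"
  using boundary_add[of "y - z" z] by (simp add: algebra_simps)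

lemma boundary_sum: "boundary (\<Sum>i\<in>I. f i) = (\<Sum>i\<in>I. boundary (f i))"
  by (induction I rule: infinite_finite_induct) (auto simp: boundary_add)

lemma lookup_cube_boundary:
  "coeff (cube_boundary (a, K)) q =
     (\<Sum>j\<in>K. bsign j K * ((if (a(j := a j + 1), K - {j}) = q then 1 else 0) -
                             (if (a, K - {j}) = q then 1 else 0)))"
  by (simp add: cube_boundary_def lookup_sum lookup_minus lookup_single bsign_def when_def)

text \<open>The boundary read from the side of the face: its coefficient collects the two cofaces in
  each missing direction. All later arguments are about single coefficients and use only this
  form.\<close>

lemma lookup_boundary:
  assumes "\<And>a K. (a, K) \<in> keys z \<Longrightarrow> K \<subseteq> {..<n}"
  shows "coeff (boundary z) (a, K) =
    (\<Sum>j\<in>{..<n} - K. bsign j K *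
       (coeff z (a(j := a j - 1), insert j K) - coeff z (a, insert j K)))"
proof -
  let ?z = "coeff z"
  let ?U = "\<lambda>j q. of_bool (j \<in> snd q \<and> (fst q)(j := fst q j + 1) = a \<and> snd q - {j} = K) :: 'a"
  let ?L = "\<lambda>j q. of_bool (j \<in> snd q \<and> fst q = a \<and> snd q - {j} = K) :: 'a"
  have "coeff (boundary z) (a, K) =
      (\<Sum>q\<in>keys z. ?z q * coeff (cube_boundary q) (a, K))"
    by (simp add: boundary_def lookup_sum)
  also have "\<dots> = (\<Sum>q\<in>keys z. \<Sum>j<n. bsign j K * (?z q * (?U j q - ?L j q)))"
  proof (rule sum.cong[OF refl])
    fix q assume q: "q \<in> keys z"
    then have "snd q \<subseteq> {..<n}" using assms[of "fst q" "snd q"] by auto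
    then have "coeff (cube_boundary q) (a, K) =
        (\<Sum>j<n. if j \<in> snd q then bsign j (snd q) *
          ((if ((fst q)(j := fst q j + 1), snd q - {j}) = (a, K) then 1 else 0) -
           (if (fst q, snd q - {j}) = (a, K) then 1 else 0)) else 0)"
      unfolding lookup_cube_boundary[of "fst q" "snd q" "(a, K)", simplified prod.collapse]
      by (intro sum.mono_neutral_cong_left) auto
    also have "\<dots> = (\<Sum>j<n. bsign j K * (?U j q - ?L j q))"
    proof (intro sum.cong refl)
      fix j
      have "bsign j (snd q) = (bsign j K :: 'a)" if "snd q - {j} = K"
        unfolding that[symmetric] by simp
      then show "(if j \<in> snd q then bsign j (snd q) *
          ((if ((fst q)(j := fst q j + 1), snd q - {j}) = (a, K) then 1 else 0) -
           (if (fst q, snd q - {j}) = (a, K) then 1 else 0)) else 0) =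
               bsign j K * (?U j q - ?L j q)"
        by auto
    qed
    finally show "?z q * coeff (cube_boundary q) (a, K) =
        (\<Sum>j<n. bsign j K * (?z q * (?U j q - ?L j q)))"
      by (simp add: sum_distrib_left mult.left_commute)
  qed
  also have "\<dots> = (\<Sum>j<n. bsign j K * ((\<Sum>q\<in>keys z. ?z q * ?U j q) -
      (\<Sum>q\<in>keys z. ?z q * ?L j q)))"
    by (subst sum.swap) (simp only: sum_distrib_left right_diff_distrib sum_subtractf)
  also have "\<dots> = (\<Sum>j<n. if j \<in> K then 0 else
      bsign j K * (?z (a(j := a j - 1), insert j K) - ?z (a, insert j K)))"
  proof (intro sum.cong refl)
    fix j
    have U: "?U j q = (if j \<notin> K \<and> q = (a(j := a j - 1), insert j K) then 1 else 0)" for q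
      by (cases q) (auto simp: fun_eq_iff split: if_splits)
    have L: "?L j q = (if j \<notin> K \<and> q = (a, insert j K) then 1 else 0)" for q
      by (cases q) auto
    have "(\<Sum>q\<in>keys z. ?z q * (if P \<and> q = q0 then 1 else 0)) = (if P then ?z q0 else 0)"
      for P q0 by (auto simp: in_keys_iff if_distrib cong: if_cong)
    then show "bsign j K * ((\<Sum>q\<in>keys z. ?z q * ?U j q) -
      (\<Sum>q\<in>keys z. ?z q * ?L j q)) = (if j \<in> K then 0 else
      bsign j K * (?z (a(j := a j - 1), insert j K) - ?z (a, insert j K)))"
      unfolding U L by simp
  qed
  also have "\<dots> = (\<Sum>j\<in>{..<n} - K. bsign j K *
       (?z (a(j := a j - 1), insert j K) - ?z (a, insert j K)))"
    by (intro sum.mono_neutral_cong_right) auto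
  finally show ?thesis .
qed

text \<open>Exchanging the two summations shows only that twice the sum vanishes, which is void in
  characteristic 2. Induction on \<open>F\<close> cancels the pairs themselves.\<close>

lemma sum_antisymmetric:
  fixes f :: "'a \<Rightarrow> 'a \<Rightarrow> 'b::ab_group_add"
  assumes "finite F" "\<And>k l. k \<in> F \<Longrightarrow> l \<in> F \<Longrightarrow> k \<noteq> l \<Longrightarrow> f k l = - f l k"
  shows "(\<Sum>k\<in>F. \<Sum>l\<in>F - {k}. f k l) = 0"
  using assms
proof (induction F)
  case (insert x F)
  have "(\<Sum>k\<in>F. \<Sum>l\<in>insert x F - {k}. f k l) = (\<Sum>k\<in>F. f k x + (\<Sum>l\<in>F - {k}. f k l))"
  proof (intro sum.cong refl)
    fix k assume "k \<in> F"
    then have "insert x F - {k} = insert x (F - {k})" using insert.hyps by auto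
    then show "(\<Sum>l\<in>insert x F - {k}. f k l) = f k x + (\<Sum>l\<in>F - {k}. f k l)"
      using insert.hyps by simp
  qed
  also have "\<dots> = (\<Sum>k\<in>F. - f x k)"
  proof -
    have "(\<Sum>k\<in>F. \<Sum>l\<in>F - {k}. f k l) = 0"
      by (rule insert.IH) (rule insert.prems, auto)
    moreover have "(\<Sum>k\<in>F. f k x) = (\<Sum>k\<in>F. - f x k)"
      using insert.hyps by (intro sum.cong refl insert.prems) auto
    ultimately show ?thesis by (simp add: sum.distrib)
  qed
  moreover have "insert x F - {x} = F" using insert.hyps by auto
  ultimately show ?case using insert.hyps by (simp add: sum_negf)
qed simp

lemma subspace_keys: "pscale.subspace {z. keys z \<subseteq> Q}"
  unfolding pscale.subspace_def by (auto dest!: keys_add[THEN subsetD]) (auto simp: in_keys_iff)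

lemma subspace_chains: "pscale.subspace (chains n X i)"
  unfolding chains_def by (rule subspace_keys)

lemma subspace_boundaries: "pscale.subspace (boundaries n X i)"
proof -
  have s: "pscale.subspace (chains n X (Suc i) :: (cube \<Rightarrow>\<^sub>0 'a) set)" by (rule subspace_chains)
  show ?thesis
    unfolding boundaries_def pscale.subspace_def
  proof safe
    show "(0 :: cube \<Rightarrow>\<^sub>0 'a) \<in> boundary ` chains n X (Suc i)"
      using boundary_zero pscale.subspace_0[OF s] by (metis imageI)
    fix y z :: "cube \<Rightarrow>\<^sub>0 'a" and c
    assume yz: "y \<in> chains n X (Suc i)"
    show "pscale c (boundary y) \<in> boundary ` chains n X (Suc i)"
      by (metis imageI boundary_pscale pscale.subspace_scale[OF s yz])
    assume z: "z \<in> chains n X (Suc i)"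
    show "boundary y + boundary z \<in> boundary ` chains n X (Suc i)"
      by (metis imageI boundary_add pscale.subspace_add[OF s yz z])
  qed
qed

lemma keys_chains_subset:
  "z \<in> chains n X i \<Longrightarrow> (a, K) \<in> keys z \<Longrightarrow> K \<subseteq> {..<n}"
  by (auto simp: chains_def cubes_def)

lemma lookup_boundary_chain:
  assumes "z \<in> chains n X i"
  shows "coeff (boundary z) (a, K) =
    (\<Sum>j\<in>{..<n} - K. bsign j K *
       (coeff z (a(j := a j - 1), insert j K) - coeff z (a, insert j K)))"
  by (rule lookup_boundary) (use assms keys_chains_subset in blast)

lemma lookup_chain_nonzero: "z \<in> chains n X i \<Longrightarrow> coeff z q \<noteq> 0 \<Longrightarrow> q \<in> cubes n X i"
  by (auto simp: chains_def in_keys_iff)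

lemma chainsI: "(\<And>q. coeff z q \<noteq> 0 \<Longrightarrow> q \<in> cubes n X i) \<Longrightarrow> z \<in> chains n X i"
  by (auto simp: chains_def in_keys_iff)

lemma in_vertices_iff: "x \<in> vertices (a, K) \<longleftrightarrow> (\<forall>k. if k \<in> K then x k \<in> {a k, a k + 1} else x k =
    a k)"
  by (simp add: vertices_def)

text \<open>The two cubes \<open>(a(l := a l - 1), insert l K)\<close> and \<open>(a, insert l K)\<close> are the cofaces of
  \<open>(a, K)\<close> in direction \<open>l\<close>.\<close>

lemma vertices_coface:
  assumes "l \<notin> K"
  shows "vertices (a, K) \<subseteq> vertices (a, insert l K)"
    and "vertices (a, K) \<subseteq> vertices (a(l := a l - 1), insert l K)"
proof -
  show "vertices (a, K) \<subseteq> vertices (a, insert l K)"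
    by (auto simp: in_vertices_iff subset_iff split: if_splits)
  show "vertices (a, K) \<subseteq> vertices (a(l := a l - 1), insert l K)"
    using assms by (auto simp: in_vertices_iff subset_iff fun_upd_def)
qed

lemma face_in_cubes:
  assumes "l \<notin> K" "l < n"
    and "(a, insert l K) \<in> cubes n X (Suc i) \<or> (a(l := a l - 1), insert l K) \<in> cubes n X (Suc i)"
  shows "(a, K) \<in> cubes n X i"
proof -
  have fin: "finite K" using assms(3) finite_subset[of K "{..<n}"] by (auto simp: cubes_def)
  have "a \<in> grid n"
    using assms by (auto simp: cubes_def grid_def)
  with assms fin vertices_coface[OF assms(1), of a] show ?thesis
    by (auto simp: cubes_def)
qed

lemma boundary_nonzero_coface:
  assumes "z \<in> chains n X i" "coeff (boundary z) (a, K) \<noteq> 0"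
  obtains l where "l < n" "l \<notin> K" "coeff z (a, insert l K) \<noteq> 0 \<or>
    coeff z (a(l := a l - 1), insert l K) \<noteq> 0"
proof -
  from assms(2) obtain j where "j \<in> {..<n} - K" "bsign j K *
       (coeff z (a(j := a j - 1), insert j K) - coeff z (a, insert j K)) \<noteq> 0"
    unfolding lookup_boundary_chain[OF assms(1)] by (meson sum.not_neutral_contains_not_neutral)
  then show ?thesis using that[of j] by (cases "coeff z (a, insert j K) = 0") auto
qed

lemma boundary_in_chains:
  assumes "z \<in> chains n X (Suc i)"
  shows "boundary z \<in> chains n X i"
proof (rule chainsI)
  fix q assume q: "coeff (boundary z) q \<noteq> 0"
  obtain a K where aK: "q = (a, K)" by force
  with q obtain l where "l < n" "l \<notin> K" "coeff z (a, insert l K) \<noteq> 0 \<or>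
    coeff z (a(l := a l - 1), insert l K) \<noteq> 0"
    using boundary_nonzero_coface[OF assms] by blast
  then show "q \<in> cubes n X i"
    unfolding aK using lookup_chain_nonzero[OF assms] by (intro face_in_cubes) auto
qed

lemma boundary_boundary:
  assumes z: "z \<in> chains n X (Suc i)"
  shows "boundary (boundary z) = 0"
proof (rule poly_mapping_eqI)
  fix q :: cube
  obtain a K where aK: "q = (a, K)" by force
  let ?z = "coeff z"
  show "coeff (boundary (boundary z)) q = coeff 0 q"
  proof (cases "finite K")
    case fin: True
    \<comment> \<open>A second difference of the coefficients, symmetric in \<open>k\<close> and
      \<open>l\<close>, while the product of the two signs is antisymmetric.\<close>
    define G where "G k l = ?z (a(k := a k - 1, l := a l - 1), insert l (insert k K)) -
      ?z (a(k := a k - 1), insert l (insert k K)) - (?z (a(l := a l - 1), insert l (insert k K)) -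
        ?z (a, insert l (insert k K)))" for k l
    have "coeff (boundary (boundary z)) (a, K) =
        (\<Sum>k\<in>{..<n} - K. \<Sum>l\<in>({..<n} - K) - {k}. bsign k K * bsign l (insert k K) * G k l)"
      unfolding lookup_boundary_chain[OF boundary_in_chains[OF z]] lookup_boundary_chain[OF z]
    proof (intro sum.cong refl)
      fix k
      have "{..<n} - insert k K = ({..<n} - K) - {k}" by auto
      then show "bsign k K *
           ((\<Sum>j\<in>{..<n} - insert k K. bsign j (insert k K) *
               (?z ((a(k := a k - 1))(j := (a(k := a k - 1)) j - 1), insert j (insert k K)) -
                ?z (a(k := a k - 1), insert j (insert k K)))) -
            (\<Sum>j\<in>{..<n} - insert k K. bsign j (insert k K) *
               (?z (a(j := a j - 1), insert j (insert k K)) - ?z (a, insert j (insert k K))))) =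
         (\<Sum>l\<in>({..<n} - K) - {k}. bsign k K * bsign l (insert k K) * G k l)"
        unfolding sum_subtractf[symmetric] sum_distrib_left
        by (auto intro!: sum.cong simp: G_def algebra_simps)
    qed
    also have "\<dots> = 0"
    proof (rule sum_antisymmetric)
      fix k l assume kl: "k \<in> {..<n} - K" "l \<in> {..<n} - K" "k \<noteq> l"
      then have "G k l = G l k"
        by (simp add: G_def insert_commute fun_upd_twist algebra_simps)
      then show "bsign k K * bsign l (insert k K) * G k l =
          - (bsign l K * bsign k (insert l K) * G l k)"
        using bsign_anticommute[OF fin, of k l, where 'a='a] kl by simp
    qed simp
    finally show ?thesis by (simp add: aK)
  next
    case False
    \<comment> \<open>The sign rules need a finite \<open>K\<close>; for an infinite one the
      coefficient is zero, because a nonzero coefficient forces \<open>K\<close> into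
      \<open>{..<n}\<close>.\<close>
    have "finite K" if nz: "coeff (boundary (boundary z)) (a, K) \<noteq> 0"
    proof -
      from boundary_nonzero_coface[OF boundary_in_chains[OF z] nz] obtain l b
        where "coeff (boundary z) (b, insert l K) \<noteq> 0" by metis
      then have "(b, insert l K) \<in> cubes n X i"
        by (rule lookup_chain_nonzero[OF boundary_in_chains[OF z]])
      then have "insert l K \<subseteq> {..<n}" by (simp add: cubes_def)
      then show "finite K" using finite_subset[of K "{..<n}"] by auto
    qed
    with False have "coeff (boundary (boundary z)) (a, K) = 0" by blast
    then show ?thesis by (simp add: aK)
  qed
qed

section \<open>Pushing chains along an edge\<close>

lemma lookup_sum_single:
  assumes "finite R" "inj_on f R"
  shows "coeff (\<Sum>r\<in>R. single (f r) (g r)) q =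
    (if q \<in> f ` R then g (the_inv_into R f q) else 0)"
proof (cases "q \<in> f ` R")
  case True
  then obtain r where r: "r \<in> R" "q = f r" by blast
  have "coeff (\<Sum>r\<in>R. single (f r) (g r)) q = (\<Sum>s\<in>R. if s = r then g s else 0)"
    unfolding lookup_sum lookup_single when_def r(2)
    using assms(2) r(1) by (intro sum.cong refl) (auto dest: inj_onD)
  also have "\<dots> = g r" using assms(1) r(1) by simp
  finally show ?thesis using r assms(2) by (simp add: the_inv_into_f_f)
next
  case False
  then show ?thesis
    by (auto simp: lookup_sum lookup_single when_def intro!: sum.neutral)
qed

text \<open>The elementary step of all chain homotopies below: the cubes in \<open>A\<close>, whose \<open>k\<close>-th factor is the
  vertex \<open>t\<close>, are pushed across the edge \<open>[e, e + 1]\<close>, one of the two edges at \<open>t\<close>; the other one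
  starts at \<open>2 * t - 1 - e\<close>.\<close>

lemma push:
  fixes z :: "cube \<Rightarrow>\<^sub>0 'k::field"
  assumes z: "z \<in> chains n Y r" and k: "k < n" and e: "e = t - 1 \<or> e = t"
    and A: "\<And>a K. (a, K) \<in> A \<Longrightarrow> k \<notin> K \<and> a k = t"
    and B: "\<And>a K. (a, K) \<in> A \<Longrightarrow> (a, K) \<in> cubes n Y r \<Longrightarrow> (a(k := e), insert k K) \<in> cubes n Y (Suc r)"
    and coface: "\<And>a K l. (a, K) \<in> A \<Longrightarrow> l < n \<Longrightarrow> l \<noteq> k \<Longrightarrow> l \<notin> K \<Longrightarrow> (a, insert l K) \<in> cubes n Y r \<Longrightarrow>
        (a, insert l K) \<in> A"
      "\<And>a K l. (a, K) \<in> A \<Longrightarrow> l < n \<Longrightarrow> l \<noteq> k \<Longrightarrow> l \<notin> K \<Longrightarrow> (a(l := a l - 1), insert l K) \<in> cubes n Y r \<Longrightarrow>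
          (a(l := a l - 1), insert l K) \<in> A"
    and cycle: "\<And>q. q \<in> A \<Longrightarrow> coeff (boundary z) q = 0"
  obtains u where "u \<in> chains n Y (Suc r)"
    "\<And>q. coeff u q \<noteq> 0 \<Longrightarrow> \<exists>a K. (a, K) \<in> A \<and> q = (a(k := e), insert k K)"
    "\<And>q. q \<in> A \<Longrightarrow> coeff (z - boundary u) q = 0"
    "\<And>a K. (a, K) \<in> A \<Longrightarrow> finite K \<Longrightarrow> coeff (z - boundary u) (a(k := e), insert k K) =
       coeff z (a(k := 2 * t - 1 - e), insert k K)"
    "\<And>a K. k \<in> K \<Longrightarrow> a k \<noteq> e \<Longrightarrow> coeff (z - boundary u) (a, K) = coeff z (a, K)"
    "\<And>a K. k \<notin> K \<Longrightarrow> coeff (z - boundary u) (a, K) \<noteq> 0 \<Longrightarrow>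
       coeff z (a, K) \<noteq> 0 \<or> coeff z (a(k := t), K) \<noteq> 0 \<and> (a k = e \<or> a k = e + 1)"
proof -
  let ?z = "coeff z"
  \<comment> \<open>The sign of the vertex \<open>t\<close> in the boundary of the edge from
    \<open>e\<close> to \<open>e + 1\<close>: negative if \<open>t\<close> is its lower end. With
    it, \<open>boundary u\<close> agrees with \<open>z\<close> on \<open>A\<close>.\<close>
  define \<epsilon> :: 'k where "\<epsilon> = (if e = t then - 1 else 1)"
  define f :: "cube \<Rightarrow> cube" where "f q = ((fst q)(k := e), insert k (snd q))" for q
  define g where "g q = \<epsilon> * bsign k (snd q) * ?z q" for q
  define R where "R = A \<inter> keys z"
  have "finite R" by (simp add: R_def)
  have inj: "inj_on f R"
  proof (rule inj_onI)
    fix p q assume pq: "p \<in> R" "q \<in> R" "f p = f q"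
    obtain a K b L where ab: "p = (a, K)" "q = (b, L)" by (cases p, cases q)
    with pq A have "k \<notin> K" "a k = t" "k \<notin> L" "b k = t" by (auto simp: R_def)
    moreover from this pq(3) have "(a(k := e))(k := t) = (b(k := e))(k := t)" "insert k K =
        insert k L"
      by (auto simp: f_def ab)
    ultimately have "a = b \<and> K = L" by (metis fun_upd_triv fun_upd_upd insert_ident)
    then show "p = q" by (simp add: ab)
  qed
  define u where "u = (\<Sum>q\<in>R. single (f q) (g q))"
  have u: "coeff u (a, K) =
    (if k \<in> K \<and> a k = e \<and> (a(k := t), K - {k}) \<in> A then \<epsilon> * bsign k K * ?z (a(k := t), K - {k})
        else 0)" for a K
  proof (cases "(a, K) \<in> f ` R")
    case True
    then obtain b L where b: "(b, L) \<in> R" "(a, K) = f (b, L)" by force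
    with A have bk: "k \<notin> L" "b k = t" by (auto simp: R_def)
    with b have "a(k := t) = b" "K - {k} = L" "a k = e" "k \<in> K" by (auto simp: f_def)
    moreover have "bsign k (insert k L) = (bsign k L :: 'k)" by simp
    moreover have "coeff u (a, K) = g (b, L)"
      using True the_inv_into_f_f[OF inj b(1)]
      unfolding u_def lookup_sum_single[OF \<open>finite R\<close> inj] b(2) by simp
    moreover have "K = insert k L" using b by (simp add: f_def)
    ultimately show ?thesis
      using b(1) by (simp add: R_def g_def)
  next
    case False
    have "?z (a(k := t), K - {k}) = 0" if "k \<in> K" "a k = e" "(a(k := t), K - {k}) \<in> A"
    proof (rule ccontr)
      assume "?z (a(k := t), K - {k}) \<noteq> 0"
      with that have "(a(k := t), K - {k}) \<in> R" by (simp add: R_def in_keys_iff)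
      moreover have "f (a(k := t), K - {k}) = (a, K)" using that by (auto simp: f_def)
      ultimately show False using False by force
    qed
    with False show ?thesis unfolding u_def lookup_sum_single[OF \<open>finite R\<close> inj] by auto
  qed
  have u_nz: "(a(k := t), K - {k}) \<in> A \<and> (a(k := t), K - {k}) \<in> cubes n Y r \<and> k \<in> K \<and> a k = e"
    if "coeff u (a, K) \<noteq> 0" for a K
    using that lookup_chain_nonzero[OF z] by (auto simp: u split: if_splits)
  have u_chain: "u \<in> chains n Y (Suc r)"
  proof (rule chainsI)
    fix q assume q: "coeff u q \<noteq> 0"
    obtain a K where aK: "q = (a, K)" by force
    from u_nz[OF q[unfolded aK]] B[of "a(k := t)" "K - {k}"] have
      "((a(k := t))(k := e), insert k (K - {k})) \<in> cubes n Y (Suc r)" "k \<in> K" "a k = e" by auto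
    then show "q \<in> cubes n Y (Suc r)" by (auto simp: aK insert_absorb)
  qed
  note bd = lookup_boundary_chain[OF u_chain]
  have u0: "coeff u (a, K) = 0" if "k \<notin> K \<or> a k \<noteq> e" for a K
    using that by (auto simp: u)
  have bd_vertex: "coeff (boundary u) (a, K) =
    bsign k K * (coeff u (a(k := a k - 1), insert k K) - coeff u (a, insert k K))"
    if "k \<notin> K" for a K
  proof -
    have "coeff (boundary u) (a, K) = (\<Sum>j\<in>{k}. bsign j K *
       (coeff u (a(j := a j - 1), insert j K) - coeff u (a, insert j K)))"
      unfolding bd using that k by (intro sum.mono_neutral_right) (auto simp: u0)
    then show ?thesis by simp
  qed
  show ?thesis
  proof (rule that[OF u_chain])
    fix q assume q: "coeff u q \<noteq> 0"
    obtain a K where aK: "q = (a, K)" by force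
    from u_nz[OF q[unfolded aK]] have "(a(k := t), K - {k}) \<in> A"
      "q = ((a(k := t))(k := e), insert k (K - {k}))" by (auto simp: aK insert_absorb)
    then show "\<exists>a K. (a, K) \<in> A \<and> q = (a(k := e), insert k K)" by blast
  next
    fix q assume q: "q \<in> A"
    obtain a K where aK: "q = (a, K)" by force
    have "k \<notin> K" "a k = t" using A q by (auto simp: aK)
    moreover from this have "a(k := t) = a" "K - {k} = K" by auto
    ultimately show "coeff (z - boundary u) q = 0"
      using e q unfolding aK lookup_minus bd_vertex[OF \<open>k \<notin> K\<close>] u by (auto simp: \<epsilon>_def)
  next
    fix a K assume q: "(a, K) \<in> A" "finite K"
    have aK: "k \<notin> K" "a k = t" using A q by auto
    have u': "coeff u (b(k := e), insert k L) = \<epsilon> * bsign k L * ?z (b, L)"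
      if "b k = t" "k \<notin> L" "(b, L) \<in> cubes n Y r \<Longrightarrow> (b, L) \<in> A" for b L
    proof -
      have "b(k := t) = b" using that by auto
      moreover have "(b, L) \<notin> A \<Longrightarrow> ?z (b, L) = 0" using that lookup_chain_nonzero[OF z] by blast
      ultimately show ?thesis using that by (auto simp: u)
    qed
    \<comment> \<open>The cofaces in the directions \<open>l \<noteq> k\<close> are pushed cubes
      too. As the signs anticommute, their sum is minus the corresponding part of the boundary of
      \<open>z\<close> at \<open>(a, K)\<close>; since that boundary vanishes, only the two cofaces
      of \<open>(a, K)\<close> in direction \<open>k\<close> remain.\<close>
    have "coeff (boundary u) (a(k := e), insert k K) =
      (\<Sum>l\<in>({..<n} - K) - {k}. - (\<epsilon> * bsign k K * (bsign l K *
        (?z (a(l := a l - 1), insert l K) - ?z (a, insert l K)))))"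
      unfolding bd
    proof (rule sum.cong)
      fix l assume "l \<in> {..<n} - K - {k}"
      then have l: "l < n" "l \<notin> K" "l \<noteq> k" by auto
      have 1: "coeff u (a(k := e), insert l (insert k K)) =
          \<epsilon> * bsign k (insert l K) * ?z (a, insert l K)"
        using u'[of a "insert l K"] aK l coface(1)[OF q(1)] by (simp add: insert_commute)
      have 2: "coeff u ((a(k := e))(l := (a(k := e)) l - 1), insert l (insert k K)) =
          \<epsilon> * bsign k (insert l K) * ?z (a(l := a l - 1), insert l K)"
        using u'[of "a(l := a l - 1)" "insert l K"] aK l coface(2)[OF q(1)]
        by (simp add: insert_commute fun_upd_twist)
      have "bsign l (insert k K) * bsign k (insert l K) = - (bsign k K * bsign l K :: 'k)"
        using aK l q(2) by (auto simp: bsign_insert)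
      moreover have "\<beta> * (\<epsilon> * \<sigma> * x - \<epsilon> * \<sigma> * y) = (\<beta> * \<sigma>) * (\<epsilon> * (x - y))" for \<beta> \<sigma> x y
        by (simp only: ring_distribs mult_ac)
      moreover have "- (x * y) * (\<epsilon> * w) = - (\<epsilon> * x * (y * w))" for x y w
        by (simp add: mult_ac)
      ultimately show "bsign l (insert k K) * (coeff u ((a(k := e))(l := (a(k := e)) l - 1),
          insert l (insert k K)) -
           coeff u (a(k := e), insert l (insert k K))) =
         - (\<epsilon> * bsign k K * (bsign l K * (?z (a(l := a l - 1), insert l K) - ?z (a, insert l K))))"
        unfolding 1 2 by (simp only:)
    qed auto
    also have "\<dots> = - (\<epsilon> * bsign k K * (coeff (boundary z) (a, K) -
        bsign k K * (?z (a(k := a k - 1), insert k K) - ?z (a, insert k K))))"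
      unfolding lookup_boundary_chain[OF z] sum_negf sum_distrib_left[symmetric]
      using k aK by (subst sum_diff1) auto
    also have "\<dots> = \<epsilon> * (?z (a(k := t - 1), insert k K) - ?z (a, insert k K))"
      using cycle[OF q(1)] aK by (simp add: mult.assoc)
    finally show "coeff (z - boundary u) (a(k := e), insert k K) =
       ?z (a(k := 2 * t - 1 - e), insert k K)"
    proof -
      assume *: "coeff (boundary u) (a(k := e), insert k K) =
          \<epsilon> * (?z (a(k := t - 1), insert k K) - ?z (a, insert k K))"
      have "a(k := t) = a" using aK by auto
      with e show ?thesis
        unfolding lookup_minus * by (auto simp: \<epsilon>_def)
    qed
  next
    fix a K assume aK: "k \<in> K" "a k \<noteq> e"
    have "coeff (boundary u) (a, K) = 0"
      unfolding bd
    proof (rule sum.neutral, rule ballI)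
      fix l assume "l \<in> {..<n} - K"
      with aK have "coeff u (a(l := a l - 1), insert l K) = 0"
        "coeff u (a, insert l K) = 0" by (intro u0; auto)+
      then show "bsign l K * (coeff u (a(l := a l - 1), insert l K) -
        coeff u (a, insert l K)) = 0" by simp
    qed
    then show "coeff (z - boundary u) (a, K) = ?z (a, K)" by (simp add: lookup_minus)
  next
    fix a K assume aK: "k \<notin> K" "coeff (z - boundary u) (a, K) \<noteq> 0"
    show "?z (a, K) \<noteq> 0 \<or> ?z (a(k := t), K) \<noteq> 0 \<and> (a k = e \<or> a k = e + 1)"
    proof (rule ccontr)
      assume *: "\<not> ?thesis"
      then have "coeff (boundary u) (a, K) = 0"
        using aK(1) unfolding bd_vertex[OF aK(1)] by (auto simp: u)
      then show False using aK(2) * by (simp add: lookup_minus)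
    qed
  qed
qed

lemma chains_mono: "X \<subseteq> Y \<Longrightarrow> chains n X i \<subseteq> chains n Y i"
  by (force simp: chains_def cubes_def)

lemma base_in_vertices: "a \<in> vertices (a, K)"
  by (simp add: in_vertices_iff)

lemma upd_in_vertices: "k \<in> K \<Longrightarrow> a(k := a k + 1) \<in> vertices (a, K)"
  by (simp add: in_vertices_iff)

section \<open>Acyclicity in positive degrees\<close>

definition pos_acyclic :: "'k::field itself \<Rightarrow> nat \<Rightarrow> point set \<Rightarrow> bool" where
  "pos_acyclic _ n Y \<longleftrightarrow> (\<forall>i>0. (cycles n Y i :: (cube \<Rightarrow>\<^sub>0 'k) set) \<subseteq> boundaries n Y i)"

text \<open>Collapse of an extreme layer in direction \<open>k\<close>, for both orientations at
  once. The edge \<open>[e, e + 1]\<close> leads from \<open>t\<close> to the inner neighbour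
  \<open>2 * e + 1 - t\<close>, and \<open>3 * t - 2 * e - 1\<close> is the neighbour on the outer
  side. Pushing a cycle across that edge clears the layer.\<close>

lemma pos_acyclic_collapse:
  assumes k: "k < n" and e: "e = t - 1 \<or> e = t"
    and shift: "\<And>x. x \<in> Y \<Longrightarrow> x k = t \<Longrightarrow> x(k := 2 * e + 1 - t) \<in> Y"
    and free: "\<And>x. x \<in> Y \<Longrightarrow> x k \<noteq> 3 * t - 2 * e - 1"
    and Y': "pos_acyclic TYPE('k::field) n (Y - {x. x k = t})"
  shows "pos_acyclic TYPE('k) n Y"
  unfolding pos_acyclic_def
proof (intro allI impI subsetI)
  fix i and z :: "cube \<Rightarrow>\<^sub>0 'k" assume i: "0 < i" and z: "z \<in> cycles n Y i"
  let ?A = "{(a, K). k \<notin> K \<and> a k = t} :: cube set"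
  from z have zc: "z \<in> chains n Y i" and z0: "boundary z = 0" by (auto simp: cycles_def)
  have B: "(a(k := e), insert k K) \<in> cubes n Y (Suc i)" if A: "(a, K) \<in> ?A" "(a, K) \<in> cubes n Y i"
      for a K
  proof -
    have "x \<in> Y" if x: "x \<in> vertices (a(k := e), insert k K)" for x
    proof -
      have "x(k := t) \<in> vertices (a, K)"
        using x A(1) by (auto simp: in_vertices_iff split: if_splits)
      with A(2) have "x(k := t) \<in> Y" by (auto simp: cubes_def)
      moreover have "x k = t \<or> x k = 2 * e + 1 - t"
        using x[unfolded in_vertices_iff, rule_format, of k] e by auto
      ultimately show "x \<in> Y" using shift[of "x(k := t)"] by (auto simp: fun_upd_idem)
    qed
    moreover have "finite K" using A(2) finite_subset[of K "{..<n}"] by (auto simp: cubes_def)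
    ultimately show ?thesis using A k by (auto simp: cubes_def grid_def)
  qed
  have A: "k \<notin> K \<and> a k = t" if "(a, K) \<in> ?A" for a K using that by simp
  have coface: "(a, insert l K) \<in> ?A" "(a(l := a l - 1), insert l K) \<in> ?A"
    if "(a, K) \<in> ?A" "l \<noteq> k" for a K l using that by auto
  have cycle: "coeff (boundary z) q = 0" for q by (simp add: z0)
  obtain u where u: "u \<in> chains n Y (Suc i)"
    and u1: "\<And>q. q \<in> ?A \<Longrightarrow> coeff (z - boundary u) q = 0"
    and u2: "\<And>a K. (a, K) \<in> ?A \<Longrightarrow> finite K \<Longrightarrow> coeff (z - boundary u) (a(k := e), insert k K) =
       coeff z (a(k := 2 * t - 1 - e), insert k K)"
    by (rule push[OF zc k e, of ?A]; ((rule A B coface cycle; assumption) | (rule that;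
        assumption)))
  let ?z = "z - boundary u"
  have z'c: "?z \<in> chains n Y i"
    by (intro pscale.subspace_diff subspace_chains zc boundary_in_chains u)
  \<comment> \<open>The edge starting at \<open>2 * t - 1 - e\<close> has the outer neighbour of
    \<open>t\<close> as an end, and no point of \<open>Y\<close> lies there.\<close>
  have other: "coeff y (a, K) = 0"
    if "y \<in> chains n Y i" "a k = 2 * t - 1 - e" "k \<in> K" for y :: "cube \<Rightarrow>\<^sub>0 'k" and a K
  proof (rule ccontr)
    assume "coeff y (a, K) \<noteq> 0"
    then have "(a, K) \<in> cubes n Y i" by (rule lookup_chain_nonzero[OF that(1)])
    then have "vertices (a, K) \<subseteq> Y" by (simp add: cubes_def)
    with base_in_vertices upd_in_vertices[OF that(3)] have "a \<in> Y" "a(k := a k + 1) \<in> Y" by blast+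
    with free[of a] free[of "a(k := a k + 1)"] that(2) e show False by auto
  qed
  have "?z \<in> chains n (Y - {x. x k = t}) i"
  proof (rule chainsI)
    fix q assume q: "coeff ?z q \<noteq> 0"
    obtain a K where aK: "q = (a, K)" by force
    have c: "(a, K) \<in> cubes n Y i" using q lookup_chain_nonzero[OF z'c] by (simp add: aK)
    then have fin: "finite K" using finite_subset[of K "{..<n}"] by (auto simp: cubes_def)
    have "x k \<noteq> t" if x: "x \<in> vertices (a, K)" for x
    proof
      assume xt: "x k = t"
      show False
      proof (cases "k \<in> K")
        case False
        then have "(a, K) \<in> ?A" using x[unfolded in_vertices_iff, rule_format, of k] xt by simp
        then show False using u1 q aK by blast
      next
        case True
        then have "a k = e \<or> a k = 2 * t - 1 - e"
          using x[unfolded in_vertices_iff, rule_format, of k] xt e by auto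
        then show False
        proof
          assume "a k = 2 * t - 1 - e"
          then show False using other[OF z'c, of a K] True q aK by simp
        next
          assume "a k = e"
          with True have "(a(k := t))(k := e) = a" "insert k (K - {k}) = K" by auto
          with u2[of "a(k := t)" "K - {k}"] fin
          have "coeff ?z (a, K) = coeff z (a(k := 2 * t - 1 - e), K)" by simp
          with other[OF zc, of "a(k := 2 * t - 1 - e)" K] True q aK show False by simp
        qed
      qed
    qed
    with c show "q \<in> cubes n (Y - {x. x k = t}) i" by (auto simp: cubes_def aK)
  qed
  moreover have "boundary ?z = 0" by (simp add: boundary_diff z0 boundary_boundary[OF u])
  ultimately have "?z \<in> cycles n (Y - {x. x k = t}) i" by (simp add: cycles_def)
  with Y' i obtain w where w: "w \<in> chains n (Y - {x. x k = t}) (Suc i)" "?z = boundary w"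
    by (auto simp: pos_acyclic_def boundaries_def)
  have "w \<in> chains n Y (Suc i)" using w(1) chains_mono[of "Y - {x. x k = t}" Y n "Suc i"] by blast
  then have "w + u \<in> chains n Y (Suc i)" using u by (intro pscale.subspace_add subspace_chains)
  moreover have "z = boundary (w + u)" using w(2) by (simp add: boundary_add algebra_simps)
  ultimately show "z \<in> boundaries n Y i" by (auto simp: boundaries_def)
qed

text \<open>A line in direction \<open>k\<close> that meets \<open>Y\<close> does so in a segment
  through the slice, so extreme layers can be peeled off. Read backwards, the induction first adds
  the layers below the slice and then those above it.\<close>

lemma pos_acyclic_retract:
  assumes k: "k < n"
    and closed: "\<And>x s. x \<in> Y \<Longrightarrow> x k \<le> s \<and> s \<le> c \<or> c \<le> s \<and> s \<le> x k \<Longrightarrow> x(k := s) \<in> Y"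
    and bounded: "\<And>x. x \<in> Y \<Longrightarrow> \<bar>x k - c\<bar> \<le> int R"
    and slice: "pos_acyclic TYPE('k::field) n (Y \<inter> {x. x k = c})"
  shows "pos_acyclic TYPE('k) n Y"
proof -
  have bounds: "c - int R \<le> x k" "x k \<le> c + int R" if "x \<in> Y" for x
    using bounded[OF that] by linarith+
  have lower: "pos_acyclic TYPE('k) n (Y \<inter> {x. c - int r \<le> x k \<and> x k \<le> c})" for r
  proof (induction r)
    case 0
    have "Y \<inter> {x. c - int 0 \<le> x k \<and> x k \<le> c} = Y \<inter> {x. x k = c}" by auto
    with slice show ?case by simp
  next
    case (Suc r)
    let ?Y = "Y \<inter> {x. c - int (Suc r) \<le> x k \<and> x k \<le> c}"
    have eq: "?Y - {x. x k = c - int (Suc r)} = Y \<inter> {x. c - int r \<le> x k \<and> x k \<le> c}" by auto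
    show ?case
    proof (rule pos_acyclic_collapse[OF k, of "c - int (Suc r)" "c - int (Suc r)"])
      fix x assume x: "x \<in> ?Y" "x k = c - int (Suc r)"
      then show "x(k := 2 * (c - int (Suc r)) + 1 - (c - int (Suc r))) \<in> ?Y"
        using closed[of x "c - int r"] by simp
    next
      show "pos_acyclic TYPE('k) n (?Y - {x. x k = c - int (Suc r)})"
        unfolding eq by (rule Suc)
    qed auto
  qed
  have upper: "pos_acyclic TYPE('k) n (Y \<inter> {x. x k \<le> c + int r})" for r
  proof (induction r)
    case 0
    have "Y \<inter> {x. x k \<le> c + int 0} = Y \<inter> {x. c - int R \<le> x k \<and> x k \<le> c}"
      using bounds by auto
    with lower show ?case by simp
  next
    case (Suc r)
    let ?Y = "Y \<inter> {x. x k \<le> c + int (Suc r)}"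
    have eq: "?Y - {x. x k = c + int (Suc r)} = Y \<inter> {x. x k \<le> c + int r}" by auto
    show ?case
    proof (rule pos_acyclic_collapse[OF k, of "c + int r" "c + int (Suc r)"])
      fix x assume x: "x \<in> ?Y" "x k = c + int (Suc r)"
      then show "x(k := 2 * (c + int r) + 1 - (c + int (Suc r))) \<in> ?Y"
        using closed[of x "c + int r"] by simp
    next
      show "pos_acyclic TYPE('k) n (?Y - {x. x k = c + int (Suc r)})"
        unfolding eq by (rule Suc)
    qed auto
  qed
  have "Y \<inter> {x. x k \<le> c + int R} = Y" using bounds by auto
  with upper[of R] show ?thesis by simp
qed

lemma pos_acyclic_no_cubes:
  assumes "\<And>i. cubes n Y (Suc i) = {}"
  shows "pos_acyclic TYPE('k::field) n Y"
  unfolding pos_acyclic_def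
proof (intro allI impI subsetI)
  fix i and z :: "cube \<Rightarrow>\<^sub>0 'k" assume "0 < i" "z \<in> cycles n Y i"
  then have "keys z = {}"
    using assms[of "i - 1"] by (auto simp: cycles_def chains_def)
  then have "z = 0" by simp
  then show "z \<in> boundaries n Y i" using pscale.subspace_0[OF subspace_boundaries] by simp
qed

text \<open>Closedness is required in each coordinate separately and therefore survives fixing some
  coordinates at the centre. The induction starts from the centre alone and releases one coordinate
  at a time, the last one first.\<close>

lemma pos_acyclic_star_shaped:
  assumes "Y \<subseteq> grid n"
    and closed: "\<And>x k s. x \<in> Y \<Longrightarrow> k < n \<Longrightarrow> x k \<le> s \<and> s \<le> c k \<or> c k \<le> s \<and> s \<le> x k \<Longrightarrow> x(k := s) \<in> Y"
    and bounded: "\<And>x k. x \<in> Y \<Longrightarrow> k < n \<Longrightarrow> \<bar>x k - c k\<bar> \<le> int R"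
  shows "pos_acyclic TYPE('k::field) n Y"
proof -
  have "pos_acyclic TYPE('k) n (Y \<inter> {x. \<forall>k<n - j. x k = c k})" if "j \<le> n" for j
    using that
  proof (induction j)
    case 0
    have "cubes n (Y \<inter> {x. \<forall>k<n. x k = c k}) (Suc i) = {}" for i
    proof safe
      fix a K assume "(a, K) \<in> cubes n (Y \<inter> {x. \<forall>k<n. x k = c k}) (Suc i)"
      then have *: "vertices (a, K) \<subseteq> {x. \<forall>k<n. x k = c k}" "K \<subseteq> {..<n}" "card K = Suc i"
        by (auto simp: cubes_def)
      then obtain k where k: "k \<in> K" by (cases "K = {}") auto
      have "\<forall>k<n. a k = c k" "\<forall>l<n. (a(k := a k + 1)) l = c l"
        using *(1) base_in_vertices[of a K] upd_in_vertices[OF k, of a] by blast+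
      moreover have "k < n" using k *(2) by auto
      ultimately have False by (metis add_cancel_right_right fun_upd_same zero_neq_one)
      then show "(a, K) \<in> {}" by simp
    qed
    then show ?case by (intro pos_acyclic_no_cubes) simp
  next
    case (Suc j)
    let ?k = "n - Suc j" let ?Y = "Y \<inter> {x. \<forall>k<?k. x k = c k}"
    have "n - j = Suc ?k" using Suc.prems by simp
    then have "?Y \<inter> {x. x ?k = c ?k} = Y \<inter> {x. \<forall>k<n - j. x k = c k}" by (auto simp: less_Suc_eq)
    with Suc show ?case
      by (intro pos_acyclic_retract[of ?k n ?Y "c ?k" R]) (auto intro!: closed bounded)
  qed
  from this[of n] show ?thesis by simp
qed

section \<open>Acyclic sets with holes\<close>

lemma finite_grid_box: "finite {x \<in> grid n. \<forall>k<n. lo \<le> x k \<and> x k \<le> hi}"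
proof -
  have "finite {x. \<forall>k. (k \<in> {..<n} \<longrightarrow> x k \<in> {lo..hi}) \<and> (k \<notin> {..<n} \<longrightarrow> x k = (0::int))}"
    by (rule finite_set_of_finite_funs) auto
  then show ?thesis by (rule finite_subset[rotated]) (auto simp: grid_def not_less)
qed

text \<open>Removing from an acyclic set \<open>Y\<close> the points of finitely many slabs. The slab \<open>j\<close> is a point \<open>v j\<close> in
  the directions \<open>S j\<close> and the full interval \<open>[-1, 1]\<close> in the other ones, where \<open>v j\<close> has the
  coordinate \<open>-1\<close>. The set \<open>N j\<close> consists of the cubes of \<open>Y\<close> that touch this slab.\<close>

locale punctured =
  fixes n :: nat and X Y :: "point set" and H :: "'j set" and S :: "'j \<Rightarrow> nat set" and v :: "'j \<Rightarrow>
      point"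
    and N :: "'j \<Rightarrow> cube set"
  assumes finite_H: "finite H"
    and S_subset: "j \<in> H \<Longrightarrow> S j \<subseteq> {..<n}"
    and v_grid: "j \<in> H \<Longrightarrow> v j \<in> grid n"
    and v_slab: "j \<in> H \<Longrightarrow> k < n \<Longrightarrow> k \<notin> S j \<Longrightarrow> v j k = -1"
    and N_disjoint: "j \<in> H \<Longrightarrow> j' \<in> H \<Longrightarrow> j \<noteq> j' \<Longrightarrow> N j \<inter> N j' = {}"
    and N_iff: "j \<in> H \<Longrightarrow> (a, K) \<in> N j \<longleftrightarrow> a \<in> grid n \<and> K \<subseteq> {..<n} \<and>
      (\<forall>k<n. if k \<in> S j then (if k \<in> K then a k = v j k - 1 \<or> a k = v j k else a k = v j k)
              else -1 \<le> a k \<and> a k + of_bool (k \<in> K) \<le> 1)"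
    and N_cubes: "j \<in> H \<Longrightarrow> (a, K) \<in> N j \<Longrightarrow> (a, K) \<in> cubes n Y (card K)"
    and N_coface: "j \<in> H \<Longrightarrow> (a, K) \<in> N j \<Longrightarrow> l \<notin> K \<Longrightarrow> (a, insert l K) \<in> cubes n Y i \<Longrightarrow>
        (a, insert l K) \<in> N j"
      "j \<in> H \<Longrightarrow> (a, K) \<in> N j \<Longrightarrow> l \<notin> K \<Longrightarrow> (a(l := a l - 1), insert l K) \<in> cubes n Y i \<Longrightarrow>
        (a(l := a l - 1), insert l K) \<in> N j"
    and X_cubes: "cubes n X i = cubes n Y i - (\<Union>j\<in>H. N j)"
begin

section \<open>Normal form of a chain near a hole\<close>

definition moves :: "'j \<Rightarrow> nat \<Rightarrow> (cube \<Rightarrow>\<^sub>0 'k::field) \<Rightarrow> (cube \<Rightarrow>\<^sub>0 'k) \<Rightarrow> bool" where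
  "moves j r z z' \<longleftrightarrow> (\<exists>u\<in>chains n Y (Suc r). keys u \<subseteq> N j \<and> z' = z - boundary u)"

lemma moves_refl: "moves j r z z"
  using pscale.subspace_0[OF subspace_chains] by (auto simp: moves_def intro!: bexI[of _ 0])

lemma moves_trans:
  assumes "moves j r x y" "moves j r y z"
  shows "moves j r x z"
proof -
  obtain u w where u: "u \<in> chains n Y (Suc r)" "keys u \<subseteq> N j" "y = x - boundary u"
    and w: "w \<in> chains n Y (Suc r)" "keys w \<subseteq> N j" "z = y - boundary w"
    using assms unfolding moves_def by blast
  have "u + w \<in> chains n Y (Suc r)" using u w by (intro pscale.subspace_add subspace_chains)
  moreover have "keys (u + w) \<subseteq> N j" using keys_add[of u w] u w by blast
  moreover have "z = x - boundary (u + w)" using u w by (simp add: boundary_add)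
  ultimately show ?thesis unfolding moves_def by blast
qed

lemma moves_chains: "moves j r z z' \<Longrightarrow> z \<in> chains n Y r \<Longrightarrow> z' \<in> chains n Y r"
  unfolding moves_def by (auto intro!: pscale.subspace_diff subspace_chains boundary_in_chains)

lemma moves_boundary: "moves j r z z' \<Longrightarrow> boundary z' = boundary z"
  unfolding moves_def by (auto simp: boundary_diff boundary_boundary)

text \<open>A boundary coefficient in \<open>N j\<close> comes from cofaces, and \<open>N j\<close>
  is closed under cofaces in \<open>Y\<close>; a chain in the disjoint set \<open>N j'\<close> has
  none of them.\<close>

lemma N_boundary:
  assumes "z \<in> chains n Y i" "j \<in> H" "j' \<in> H" "j \<noteq> j'" "keys z \<subseteq> N j'" "q \<in> N j"
  shows "coeff (boundary z) q = 0"
proof (rule ccontr)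
  assume nz: "coeff (boundary z) q \<noteq> 0"
  obtain a K where q: "q = (a, K)" by force
  obtain l where l: "l \<notin> K" "coeff z (a, insert l K) \<noteq> 0 \<or>
    coeff z (a(l := a l - 1), insert l K) \<noteq> 0"
    using boundary_nonzero_coface[OF assms(1) nz[unfolded q]] by blast
  then obtain p where p: "coeff z p \<noteq> 0" "p = (a, insert l K) \<or> p = (a(l := a l - 1), insert l K)"
    by blast
  have "p \<in> cubes n Y i" by (rule lookup_chain_nonzero[OF assms(1) p(1)])
  then have "p \<in> N j" using p(2) N_coface[OF assms(2) assms(6)[unfolded q] l(1)] by auto
  moreover have "p \<in> N j'" using p(1) assms(5) by (auto simp: in_keys_iff)
  ultimately show False using N_disjoint assms by blast
qed

text \<open>The reason for restricting \<open>moves\<close> to chains inside \<open>N j\<close>: a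
  normal form reached at one hole survives the work at the others.\<close>

lemma moves_other:
  assumes "moves j' r z z'" "j \<in> H" "j' \<in> H" "j \<noteq> j'" "q \<in> N j"
  shows "coeff z' q = coeff z q"
  using assms(1) N_boundary[OF _ assms(2-4) _ assms(5)] by (auto simp: moves_def lookup_minus)

text \<open>The factors allowed are an edge in a direction of \<open>S j\<close> and the end
  \<open>-1\<close> of the interval \<open>[-1, 1]\<close> in a slab direction. With all directions
  in \<open>F\<close>, only the cubes of one disc transverse to the slab remain.\<close>

definition tidy :: "'j \<Rightarrow> nat set \<Rightarrow> (cube \<Rightarrow>\<^sub>0 'k::field) \<Rightarrow> bool" where
  "tidy j F z \<longleftrightarrow> (\<forall>a K. (a, K) \<in> N j \<longrightarrow> coeff z (a, K) \<noteq> 0 \<longrightarrow>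
     (\<forall>k\<in>F. if k \<in> S j then k \<in> K else k \<notin> K \<and> a k = -1))"

lemma push_N:
  fixes z :: "cube \<Rightarrow>\<^sub>0 'k::field"
  assumes j: "j \<in> H" and k: "k < n" and z: "z \<in> chains n Y r"
    and cycle: "\<And>q. q \<in> N j \<Longrightarrow> coeff (boundary z) q = 0"
    and low: "\<And>a K. (a, K) \<in> N j \<Longrightarrow> k \<notin> K \<Longrightarrow> a k = t \<Longrightarrow> (a(k := t - 1), insert k K) \<in> N j"
  obtains z' where "moves j r z z'"
    "\<And>a K. (a, K) \<in> N j \<Longrightarrow> k \<notin> K \<Longrightarrow> a k = t \<Longrightarrow> coeff z' (a, K) = 0"
    "\<And>a K. (a, K) \<in> N j \<Longrightarrow> k \<notin> K \<Longrightarrow> a k = t \<Longrightarrow>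
       coeff z' (a(k := t - 1), insert k K) = coeff z (a, insert k K)"
    "\<And>a K. k \<in> K \<Longrightarrow> a k \<noteq> t - 1 \<Longrightarrow> coeff z' (a, K) = coeff z (a, K)"
    "\<And>a K. k \<notin> K \<Longrightarrow> coeff z' (a, K) \<noteq> 0 \<Longrightarrow>
       coeff z (a, K) \<noteq> 0 \<or> coeff z (a(k := t), K) \<noteq> 0 \<and> (a k = t - 1 \<or> a k = t)"
proof -
  define A where "A = {(a, K) \<in> N j. k \<notin> K \<and> a k = t}"
  have A: "k \<notin> K \<and> a k = t" if "(a, K) \<in> A" for a K using that by (simp add: A_def)
  have B: "(a(k := t - 1), insert k K) \<in> cubes n Y (Suc r)" if "(a, K) \<in> A" "(a, K) \<in> cubes n Y r"
      for a K
  proof -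
    have "finite K" using that(2) finite_subset[of K "{..<n}"] by (auto simp: cubes_def)
    then have "card (insert k K) = Suc r" using that A[of a K] by (auto simp: cubes_def)
    with N_cubes[OF j, of "a(k := t - 1)" "insert k K"] low that show ?thesis by (auto simp: A_def)
  qed
  have coface: "(a, K) \<in> A \<Longrightarrow> l < n \<Longrightarrow> l \<noteq> k \<Longrightarrow> l \<notin> K \<Longrightarrow> (a, insert l K) \<in> cubes n Y r \<Longrightarrow>
      (a, insert l K) \<in> A"
    "(a, K) \<in> A \<Longrightarrow> l < n \<Longrightarrow> l \<noteq> k \<Longrightarrow> l \<notin> K \<Longrightarrow> (a(l := a l - 1), insert l K) \<in> cubes n Y r \<Longrightarrow>
        (a(l := a l - 1), insert l K) \<in> A"
    for a K l using N_coface[OF j] by (auto simp: A_def)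
  have cyc: "coeff (boundary z) q = 0" if "q \<in> A" for q
    using that cycle by (auto simp: A_def)
  obtain u where u: "u \<in> chains n Y (Suc r)"
    and u1: "\<And>q. coeff u q \<noteq> 0 \<Longrightarrow> \<exists>a K. (a, K) \<in> A \<and> q = (a(k := t - 1), insert k K)"
    and u2: "\<And>q. q \<in> A \<Longrightarrow> coeff (z - boundary u) q = 0"
    and u3: "\<And>a K. (a, K) \<in> A \<Longrightarrow> finite K \<Longrightarrow> coeff (z - boundary u) (a(k := t - 1), insert k K) =
       coeff z (a(k := 2 * t - 1 - (t - 1)), insert k K)"
    and u4: "\<And>a K. k \<in> K \<Longrightarrow> a k \<noteq> t - 1 \<Longrightarrow> coeff (z - boundary u) (a, K) = coeff z (a, K)"
    and u5: "\<And>a K. k \<notin> K \<Longrightarrow> coeff (z - boundary u) (a, K) \<noteq> 0 \<Longrightarrow>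
       coeff z (a, K) \<noteq> 0 \<or> coeff z (a(k := t), K) \<noteq> 0 \<and> (a k = t - 1 \<or> a k = t - 1 + 1)"
    by (rule push[OF z k disjI1[OF refl], of A]; ((rule A B coface cyc; assumption) | (rule that;
        assumption)))
  show ?thesis
  proof (rule that)
    have "keys u \<subseteq> N j" using u1 low by (force simp: in_keys_iff A_def)
    with u show "moves j r z (z - boundary u)" by (auto simp: moves_def)
    show "coeff (z - boundary u) (a, K) = 0" if "(a, K) \<in> N j" "k \<notin> K" "a k = t" for a K
      using that by (intro u2) (simp add: A_def)
    show "coeff (z - boundary u) (a(k := t - 1), insert k K) = coeff z (a, insert k K)"
      if "(a, K) \<in> N j" "k \<notin> K" "a k = t" for a K
    proof -
      have "finite K" using that(1) N_iff[OF j] finite_subset[of K "{..<n}"] by auto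
      with that u3[of a K] show ?thesis by (auto simp: A_def fun_upd_idem)
    qed
  qed (use u4 u5 in auto)
qed

lemma N_face:
  assumes "j \<in> H" "(a, insert k K) \<in> N j" "k \<notin> K" "k < n" "if k \<in> S j then t = v j k else -1 \<le> t \<and>
      t \<le> 1"
  shows "(a(k := t), K) \<in> N j"
  using assms by (auto simp: N_iff grid_def)

text \<open>In a direction of \<open>S j\<close>, a vertex factor in \<open>N j\<close> can only be
  \<open>v j k\<close>, so a single push down removes all of these cubes. Afterwards the lower edge
  carries the coefficient of the upper one, which keeps the directions in \<open>F\<close>
  tidy.\<close>

lemma tidy_star:
  fixes z :: "cube \<Rightarrow>\<^sub>0 'k::field"
  assumes j: "j \<in> H" and k: "k < n" "k \<in> S j" and z: "z \<in> chains n Y r"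
    and cycle: "\<And>q. q \<in> N j \<Longrightarrow> coeff (boundary z) q = 0"
    and tidy: "tidy j F z"
  shows "\<exists>z'. moves j r z z' \<and> tidy j (insert k F) z'"
proof -
  have low: "(a(k := v j k - 1), insert k K) \<in> N j" if "(a, K) \<in> N j" "k \<notin> K" "a k = v j k" for a K
    using that k by (auto simp: N_iff[OF j] grid_def)
  obtain z' where m: "moves j r z z'"
    and 1: "\<And>a K. (a, K) \<in> N j \<Longrightarrow> k \<notin> K \<Longrightarrow> a k = v j k \<Longrightarrow> coeff z' (a, K) = 0"
    and 2: "\<And>a K. (a, K) \<in> N j \<Longrightarrow> k \<notin> K \<Longrightarrow> a k = v j k \<Longrightarrow>
       coeff z' (a(k := v j k - 1), insert k K) = coeff z (a, insert k K)"
    and 3: "\<And>a K. k \<in> K \<Longrightarrow> a k \<noteq> v j k - 1 \<Longrightarrow> coeff z' (a, K) = coeff z (a, K)"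
    by (rule push_N[OF j k(1) z, of "v j k"]; ((rule cycle low; assumption) | (rule that;
        assumption)))
  have "tidy j (insert k F) z'"
    unfolding tidy_def
  proof (intro allI impI)
    fix a K assume aK: "(a, K) \<in> N j" "coeff z' (a, K) \<noteq> 0"
    have "k \<in> K"
    proof (rule ccontr)
      assume "k \<notin> K"
      with aK(1) k have "a k = v j k" by (auto simp: N_iff[OF j])
      with 1 aK \<open>k \<notin> K\<close> show False by blast
    qed
    then have K: "insert k (K - {k}) = K" by auto
    have "\<forall>l\<in>F - {k}. if l \<in> S j then l \<in> K else l \<notin> K \<and> a l = -1"
    proof (cases "a k = v j k - 1")
      case False
      then show ?thesis using 3[OF \<open>k \<in> K\<close>] aK tidy by (auto simp: tidy_def)
    next
      case True
      let ?a = "a(k := v j k)"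
      have "(?a, K - {k}) \<in> N j"
        using N_face[OF j, of a k "K - {k}" "v j k"] aK(1) k K by simp
      moreover have "?a(k := v j k - 1) = a" using True by auto
      ultimately have "coeff z (?a, K) \<noteq> 0"
        using 2[of ?a "K - {k}"] aK(2) K by simp
      moreover have "(?a, K) \<in> N j" using aK(1) k \<open>k \<in> K\<close> by (auto simp: N_iff[OF j] grid_def)
      ultimately have "\<forall>l\<in>F. if l \<in> S j then l \<in> K else l \<notin> K \<and> ?a l = -1"
        using tidy unfolding tidy_def by blast
      then show ?thesis by auto
    qed
    then have "if l \<in> S j then l \<in> K else l \<notin> K \<and> a l = -1" if "l \<in> insert k F" for l
      using that \<open>k \<in> K\<close> k by (cases "l = k") auto
    then show "\<forall>l\<in>insert k F. if l \<in> S j then l \<in> K else l \<notin> K \<and> a l = -1" by blast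
  qed
  with m show ?thesis by blast
qed

text \<open>One layer of a slab direction is pushed down. As nothing lies above \<open>t\<close>,
  the edge below \<open>t\<close> is left with the zero coefficient of the edge above.\<close>

lemma lower_slab:
  fixes z :: "cube \<Rightarrow>\<^sub>0 'k::field"
  assumes j: "j \<in> H" and k: "k < n" "k \<notin> S j" "k \<notin> F" and z: "z \<in> chains n Y r"
    and cycle: "\<And>q. q \<in> N j \<Longrightarrow> coeff (boundary z) q = 0"
    and tidy: "tidy j F z" and t: "t = 0 \<or> t = 1"
    and top: "\<And>a K. (a, K) \<in> N j \<Longrightarrow> coeff z (a, K) \<noteq> 0 \<Longrightarrow> a k + of_bool (k \<in> K) \<le> t"
  shows "\<exists>z'. moves j r z z' \<and> tidy j F z' \<and>
    (\<forall>a K. (a, K) \<in> N j \<longrightarrow> coeff z' (a, K) \<noteq> 0 \<longrightarrow> a k + of_bool (k \<in> K) \<le> t - 1)"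
proof -
  have low: "(a(k := t - 1), insert k K) \<in> N j" if "(a, K) \<in> N j" "k \<notin> K" "a k = t" for a K
    using that k t by (auto simp: N_iff[OF j] grid_def)
  obtain z' where m: "moves j r z z'"
    and 1: "\<And>a K. (a, K) \<in> N j \<Longrightarrow> k \<notin> K \<Longrightarrow> a k = t \<Longrightarrow> coeff z' (a, K) = 0"
    and 2: "\<And>a K. (a, K) \<in> N j \<Longrightarrow> k \<notin> K \<Longrightarrow> a k = t \<Longrightarrow>
       coeff z' (a(k := t - 1), insert k K) = coeff z (a, insert k K)"
    and 3: "\<And>a K. k \<in> K \<Longrightarrow> a k \<noteq> t - 1 \<Longrightarrow> coeff z' (a, K) = coeff z (a, K)"
    and 4: "\<And>a K. k \<notin> K \<Longrightarrow> coeff z' (a, K) \<noteq> 0 \<Longrightarrow>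
       coeff z (a, K) \<noteq> 0 \<or> coeff z (a(k := t), K) \<noteq> 0 \<and> (a k = t - 1 \<or> a k = t)"
    by (rule push_N[OF j k(1) z, of t]; ((rule cycle low; assumption) | (rule that; assumption)))
  have "a k + of_bool (k \<in> K) \<le> t - 1 \<and>
      (\<exists>s. (a(k := s), K) \<in> N j \<and> coeff z (a(k := s), K) \<noteq> 0)"
    if aK: "(a, K) \<in> N j" "coeff z' (a, K) \<noteq> 0" for a K
  proof (cases "k \<in> K")
    case False
    with 1 aK have "a k \<noteq> t" by blast
    from 4[OF False aK(2)] show ?thesis
    proof
      assume "coeff z (a, K) \<noteq> 0"
      moreover from top[OF aK(1) this] \<open>a k \<noteq> t\<close> False have "a k + of_bool (k \<in> K) \<le> t - 1" by simp
      moreover have "a(k := a k) = a" by simp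
      ultimately show ?thesis using aK(1) by metis
    next
      assume *: "coeff z (a(k := t), K) \<noteq> 0 \<and> (a k = t - 1 \<or> a k = t)"
      moreover have "(a(k := t), K) \<in> N j"
        using aK(1) False k t by (auto simp: N_iff[OF j] grid_def)
      ultimately show ?thesis using \<open>a k \<noteq> t\<close> False by auto
    qed
  next
    case True
    then have K: "insert k (K - {k}) = K" by auto
    show ?thesis
    proof (cases "a k = t - 1")
      case False
      then have "coeff z (a, K) \<noteq> 0" using 3[OF True] aK(2) by simp
      moreover from top[OF aK(1) this] False True have "a k + of_bool (k \<in> K) \<le> t - 1" by simp
      moreover have "a(k := a k) = a" by simp
      ultimately show ?thesis using aK(1) by metis
    next
      case eq: True
      \<comment> \<open>The contradictory case: the coefficient would be that of an edge reaching
        \<open>t + 1\<close>, against \<open>top\<close>.\<close>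
      let ?a = "a(k := t)"
      have "(?a, K - {k}) \<in> N j"
        using N_face[OF j, of a k "K - {k}" t] aK(1) k K t by auto
      moreover have "?a(k := t - 1) = a" using eq by auto
      ultimately have nz: "coeff z (?a, K) \<noteq> 0"
        using 2[of ?a "K - {k}"] aK(2) K by simp
      have "(?a, insert k (K - {k})) \<in> N j"
        using N_coface(1)[OF j \<open>(?a, K - {k}) \<in> N j\<close>, of k r] lookup_chain_nonzero[OF z nz] K
            by simp
      with top[of ?a K] nz K True show ?thesis by auto
    qed
  qed
  note * = this
  have "tidy j F z'"
    unfolding tidy_def
  proof (intro allI impI)
    fix a K assume aK: "(a, K) \<in> N j" "coeff z' (a, K) \<noteq> 0"
    then obtain s where "(a(k := s), K) \<in> N j" "coeff z (a(k := s), K) \<noteq> 0" using * by blast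
    then have "\<forall>l\<in>F. if l \<in> S j then l \<in> K else l \<notin> K \<and> (a(k := s)) l = -1"
      using tidy unfolding tidy_def by blast
    with k(3) show "\<forall>l\<in>F. if l \<in> S j then l \<in> K else l \<notin> K \<and> a l = -1"
      by (auto split: if_splits)
  qed
  with m * show ?thesis by blast
qed

text \<open>Two passes, at \<open>t = 1\<close> and at \<open>t = 0\<close>, sweep the interval
  \<open>[-1, 1]\<close> down to \<open>-1\<close>.\<close>

lemma tidy_slab:
  fixes z :: "cube \<Rightarrow>\<^sub>0 'k::field"
  assumes j: "j \<in> H" and k: "k < n" "k \<notin> S j" "k \<notin> F" and z: "z \<in> chains n Y r"
    and cycle: "\<And>q. q \<in> N j \<Longrightarrow> coeff (boundary z) q = 0"
    and tidy: "tidy j F z"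
  shows "\<exists>z'. moves j r z z' \<and> tidy j (insert k F) z'"
proof -
  have "\<exists>z'. moves j r z z' \<and> tidy j F z' \<and>
    (\<forall>a K. (a, K) \<in> N j \<longrightarrow> coeff z' (a, K) \<noteq> 0 \<longrightarrow> a k + of_bool (k \<in> K) \<le> 1 - 1)"
  proof (rule lower_slab[OF j k z _ tidy])
    show "a k + of_bool (k \<in> K) \<le> 1" if "(a, K) \<in> N j" for a K
      using that k by (auto simp: N_iff[OF j])
  qed (use cycle in auto)
  then obtain z1 where m1: "moves j r z z1" and t1: "tidy j F z1"
    and top1: "\<And>a K. (a, K) \<in> N j \<Longrightarrow> coeff z1 (a, K) \<noteq> 0 \<Longrightarrow> a k + of_bool (k \<in> K) \<le> 0"
    by auto
  have "\<exists>z'. moves j r z1 z' \<and> tidy j F z' \<and>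
    (\<forall>a K. (a, K) \<in> N j \<longrightarrow> coeff z' (a, K) \<noteq> 0 \<longrightarrow> a k + of_bool (k \<in> K) \<le> 0 - 1)"
    by (rule lower_slab[OF j k moves_chains[OF m1 z] _ t1])
      (use cycle moves_boundary[OF m1] top1 in auto)
  then obtain z2 where m2: "moves j r z1 z2" and t2: "tidy j F z2"
    and top2: "\<And>a K. (a, K) \<in> N j \<Longrightarrow> coeff z2 (a, K) \<noteq> 0 \<Longrightarrow> a k + of_bool (k \<in> K) \<le> -1"
    by auto
  have "k \<notin> K \<and> a k = -1" if "(a, K) \<in> N j" "coeff z2 (a, K) \<noteq> 0" for a K
  proof -
    have "-1 \<le> a k" using that(1) k by (auto simp: N_iff[OF j])
    with top2[OF that] show ?thesis by (auto simp: of_bool_def split: if_splits)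
  qed
  with t2 k have "tidy j (insert k F) z2" by (simp add: tidy_def)
  with moves_trans[OF m1 m2] show ?thesis by blast
qed

lemma tidy_all:
  fixes z :: "cube \<Rightarrow>\<^sub>0 'k::field"
  assumes j: "j \<in> H" and z: "z \<in> chains n Y r"
    and cycle: "\<And>q. q \<in> N j \<Longrightarrow> coeff (boundary z) q = 0"
  shows "\<exists>z'. moves j r z z' \<and> tidy j {..<n} z'"
proof -
  have "\<exists>z'. moves j r z z' \<and> tidy j {..<k} z'" if "k \<le> n" for k
    using that
  proof (induction k)
    case 0
    show ?case using moves_refl by (auto simp: tidy_def)
  next
    case (Suc k)
    then obtain z1 where m: "moves j r z z1" "tidy j {..<k} z1" by auto
    have cycle1: "coeff (boundary z1) q = 0" if "q \<in> N j" for q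
      using cycle that moves_boundary[OF m(1)] by simp
    have "\<exists>z'. moves j r z1 z' \<and> tidy j (insert k {..<k}) z'"
    proof (cases "k \<in> S j")
      case True
      then show ?thesis using Suc.prems by (intro tidy_star j moves_chains[OF m(1) z] cycle1 m(2))
          auto
    next
      case False
      then show ?thesis using Suc.prems by (intro tidy_slab j moves_chains[OF m(1) z] cycle1 m(2))
          auto
    qed
    then show ?case using moves_trans[OF m(1)] by (auto simp: lessThan_Suc)
  qed
  then show ?thesis by blast
qed

section \<open>Discs transverse to the slabs\<close>

definition ring :: "'j \<Rightarrow> cube set" where
  "ring j = {(a, K). K = S j \<and> a \<in> grid n \<and> (\<forall>k<n. if k \<in> S j then a k = v j k - 1 \<or> a k =
      v j k else a k = -1)}"

text \<open>The disc of all cubes around \<open>v j\<close> in the directions \<open>S j\<close>,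
  placed at the end \<open>-1\<close> of the slab. The cubes are translates of each other, hence the
  constant coefficient 1; the boundary is the sphere around the hole.\<close>

definition ring_chain :: "'j \<Rightarrow> cube \<Rightarrow>\<^sub>0 'k::field" where
  "ring_chain j = (\<Sum>q\<in>ring j. single q 1)"

lemma finite_S: "j \<in> H \<Longrightarrow> finite (S j)"
  using S_subset finite_subset by blast

lemma finite_ring:
  assumes j: "j \<in> H"
  shows "finite (ring j)"
proof -
  have "q \<in> (\<lambda>I. (\<lambda>k. v j k - of_bool (k \<in> I), S j)) ` Pow (S j)" if q: "q \<in> ring j" for q
  proof -
    obtain a where a: "q = (a, S j)" "a \<in> grid n"
      "\<And>k. k < n \<Longrightarrow> if k \<in> S j then a k = v j k - 1 \<or> a k = v j k else a k = -1"
      using q by (auto simp: ring_def)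
    have "a k = v j k - of_bool (k \<in> {k \<in> S j. a k \<noteq> v j k})" for k
      using a(2) a(3)[of k] v_grid[OF j] v_slab[OF j, of k] S_subset[OF j]
      by (cases "k < n") (auto simp: grid_def split: if_splits)
    then have "q = (\<lambda>I. (\<lambda>k. v j k - of_bool (k \<in> I), S j)) {k \<in> S j. a k \<noteq> v j k}"
      using a(1) by auto
    then show ?thesis by (rule image_eqI) auto
  qed
  then have "ring j \<subseteq> (\<lambda>I. (\<lambda>k. v j k - of_bool (k \<in> I), S j)) ` Pow (S j)" by (rule subsetI)
  then show ?thesis by (rule finite_subset) (simp add: finite_S[OF j])
qed

lemma lookup_ring_chain:
  assumes "j \<in> H"
  shows "coeff (ring_chain j) q = of_bool (q \<in> ring j)"
  using finite_ring[OF assms] by (simp add: ring_chain_def lookup_sum lookup_single when_def)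

lemma ring_subset_N:
  assumes j: "j \<in> H"
  shows "ring j \<subseteq> N j"
proof
  fix q assume "q \<in> ring j"
  then obtain a where a: "q = (a, S j)" "a \<in> grid n"
      "\<And>k. k < n \<Longrightarrow> if k \<in> S j then a k = v j k - 1 \<or> a k = v j k else a k = -1"
    by (auto simp: ring_def)
  have "if k \<in> S j then (if k \<in> S j then a k = v j k - 1 \<or> a k = v j k else a k = v j k)
              else -1 \<le> a k \<and> a k + of_bool (k \<in> S j) \<le> 1" if "k < n" for k
    using a(3)[OF that] by (auto split: if_splits)
  with a(2) S_subset[OF j] show "q \<in> N j" unfolding a(1) N_iff[OF j] by blast
qed

lemma keys_ring_chain: "j \<in> H \<Longrightarrow> keys (ring_chain j) \<subseteq> N j"
  using ring_subset_N by (force simp: in_keys_iff lookup_ring_chain)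

lemma ring_chain_chains:
  assumes "j \<in> H"
  shows "ring_chain j \<in> chains n Y (card (S j))"
proof (rule chainsI)
  fix q assume "coeff (ring_chain j) q \<noteq> 0"
  then have "q \<in> ring j" by (auto simp: lookup_ring_chain[OF assms])
  then show "q \<in> cubes n Y (card (S j))"
    using ring_subset_N[OF assms] N_cubes[OF assms] by (auto simp: ring_def)
qed

text \<open>A facet of the disc that touches the slab is an inner one: it has
  \<open>a l = v j l\<close> in the missing direction, and the cubes on its two sides cancel. The
  boundary is thus a chain of \<open>X\<close>.\<close>

lemma boundary_ring_chain:
  assumes j: "j \<in> H" and j': "j' \<in> H" and q: "q \<in> N j'"
  shows "coeff (boundary (ring_chain j)) q = 0"
proof (cases "j' = j")
  case False
  then show ?thesis using N_boundary[OF ring_chain_chains j' j _ keys_ring_chain q] j by auto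
next
  case True
  obtain a K where aK: "q = (a, K)" by force
  have N: "(a, K) \<in> N j" using q True aK by simp
  have "coeff (boundary (ring_chain j)) (a, K) = 0"
    unfolding lookup_boundary_chain[OF ring_chain_chains[OF j]]
  proof (rule sum.neutral, rule ballI)
    fix l assume l: "l \<in> {..<n} - K"
    have "(a(l := a l - 1), insert l K) \<in> ring j \<longleftrightarrow> (a, insert l K) \<in> ring j"
    proof (cases "insert l K = S j")
      case True
      then have "l \<in> S j" by auto
      with l N have al: "a l = v j l" by (auto simp: N_iff[OF j])
      have "(if k \<in> S j then (a(l := a l - 1)) k = v j k - 1 \<or> (a(l := a l - 1)) k =
          v j k else (a(l := a l - 1)) k = -1) \<longleftrightarrow>
         (if k \<in> S j then a k = v j k - 1 \<or> a k = v j k else a k = -1)" for k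
        using \<open>l \<in> S j\<close> al by (cases "k = l") auto
      moreover have "a(l := a l - 1) \<in> grid n \<longleftrightarrow> a \<in> grid n" using l by (auto simp: grid_def)
      ultimately show ?thesis by (simp add: ring_def)
    qed (auto simp: ring_def)
    then show "bsign l K * (coeff (ring_chain j) (a(l := a l - 1), insert l K) -
        coeff (ring_chain j) (a, insert l K)) = 0"
      by (simp add: lookup_ring_chain[OF j])
  qed
  then show ?thesis by (simp add: aK)
qed

text \<open>At an inner facet the cycle condition equates the coefficients of the two adjacent cubes
  of the disc. Crossing one facet for every coordinate in which \<open>a\<close> differs from
  \<open>v j\<close> connects each cube to \<open>(v j, S j)\<close>.\<close>

lemma tidy_multiple_ring:
  fixes z :: "cube \<Rightarrow>\<^sub>0 'k::field"
  assumes j: "j \<in> H" and z: "z \<in> chains n Y r"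
    and cycle: "\<And>q. q \<in> N j \<Longrightarrow> coeff (boundary z) q = 0"
    and tidy: "tidy j {..<n} z" and q: "q \<in> N j"
  shows "coeff z q = coeff z (v j, S j) * of_bool (q \<in> ring j)"
proof (cases "q \<in> ring j")
  case False
  obtain a K where aK: "q = (a, K)" by force
  have "coeff z q = 0"
  proof (rule ccontr)
    assume "coeff z q \<noteq> 0"
    then have *: "if k \<in> S j then k \<in> K else k \<notin> K \<and> a k = -1" if "k < n" for k
      using tidy q that by (auto simp: tidy_def aK)
    have N: "a \<in> grid n" "K \<subseteq> {..<n}" "\<And>k. k < n \<Longrightarrow> if k \<in> S j then (if k \<in> K then a k =
        v j k - 1 \<or> a k = v j k else a k = v j k)
              else -1 \<le> a k \<and> a k + of_bool (k \<in> K) \<le> 1"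
      using q by (auto simp: N_iff[OF j] aK)
    have "K = S j" using *  N(2) S_subset[OF j]
        by (auto split: if_splits) (meson lessThan_iff subsetD)+
    moreover have "if k \<in> S j then a k = v j k - 1 \<or> a k = v j k else a k = -1" if "k < n" for k
      using *[OF that] N(3)[OF that] by (auto split: if_splits)
    ultimately have "q \<in> ring j" using N(1) by (simp add: ring_def aK)
    with False show False ..
  qed
  with False show ?thesis by simp
next
  case True
  have "coeff z (a, S j) = coeff z (v j, S j)"
    if "(a, S j) \<in> ring j" "card {k \<in> S j. a k \<noteq> v j k} = m" for a m
    using that
  proof (induction m arbitrary: a)
    case 0
    have "a k = v j k" for k
    proof (cases "k < n")
      case True
      then show ?thesis using 0 finite_S[OF j] v_slab[OF j True]
          by (cases "k \<in> S j") (auto simp: ring_def)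
    next
      case False
      then show ?thesis using 0 v_grid[OF j] by (auto simp: ring_def grid_def)
    qed
    then have "a = v j" by auto
    then show ?case by simp
  next
    case (Suc m)
    then obtain k where k: "k \<in> S j" "a k \<noteq> v j k"
        by (metis (mono_tags, lifting) Collect_empty_eq card.empty nat.distinct(1))
    then have kn: "k < n" using S_subset[OF j] by auto
    let ?a = "a(k := v j k)"
    have ak: "a k = v j k - 1" using Suc.prems(1) k kn by (auto simp: ring_def)
    have ring: "(?a, S j) \<in> ring j" using Suc.prems(1) kn k by (auto simp: ring_def grid_def)
    have "{l \<in> S j. ?a l \<noteq> v j l} = {l \<in> S j. a l \<noteq> v j l} - {k}" by auto
    then have "card {l \<in> S j. ?a l \<noteq> v j l} = m" using Suc.prems(2) k finite_S[OF j] by simp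
    with Suc.IH ring have IH: "coeff z (?a, S j) = coeff z (v j, S j)" by blast
    have face: "(?a, S j - {k}) \<in> N j"
      using N_face[OF j, of ?a k "S j - {k}" "v j k"] ring_subset_N[OF j] ring k kn
          by (auto simp: insert_absorb)
    \<comment> \<open>Cofaces of the inner facet in other directions still lack the direction
      \<open>k\<close> of \<open>S j\<close>; tidiness gives them coefficient zero.\<close>
    have z0: "coeff z p = 0"
      if p: "p = (b, insert l (S j - {k}))" "p \<in> cubes n Y r \<Longrightarrow> p \<in> N j" and "l \<noteq> k" for p b l
    proof (rule ccontr)
      assume nz: "coeff z p \<noteq> 0"
      with lookup_chain_nonzero[OF z] p have "p \<in> N j" by blast
      with tidy nz p(1) have "\<forall>i\<in>{..<n}. if i \<in> S j then i \<in> insert l (S j - {k}) else i \<notin> insert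
          l (S j - {k}) \<and> b i = -1"
        unfolding tidy_def by blast
      then have "k \<in> insert l (S j - {k})" using kn k(1) by (metis lessThan_iff)
      then show False using \<open>l \<noteq> k\<close> by simp
    qed
    have "0 = coeff (boundary z) (?a, S j - {k})" using cycle[OF face] by simp
    also have "\<dots> = (\<Sum>l\<in>{k}. bsign l (S j - {k}) *
       (coeff z (?a(l := ?a l - 1), insert l (S j - {k})) - coeff z (?a, insert l (S j - {k}))))"
      unfolding lookup_boundary_chain[OF z]
    proof (rule sum.mono_neutral_right)
      show "\<forall>l\<in>{..<n} - (S j - {k}) - {k}. bsign l (S j - {k}) *
         (coeff z (?a(l := ?a l - 1), insert l (S j - {k})) - coeff z (?a, insert l (S j - {k})))
             = 0"
      proof
        fix l assume l: "l \<in> {..<n} - (S j - {k}) - {k}"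
        then have lS: "l \<notin> S j - {k}" "l \<noteq> k" by auto
        have "coeff z (?a(l := ?a l - 1), insert l (S j - {k})) = 0"
          by (rule z0[OF refl _ lS(2)]) (rule N_coface(2)[OF j face lS(1)])
        moreover have "coeff z (?a, insert l (S j - {k})) = 0"
          by (rule z0[OF refl _ lS(2)]) (rule N_coface(1)[OF j face lS(1)])
        ultimately show "bsign l (S j - {k}) *
         (coeff z (?a(l := ?a l - 1), insert l (S j - {k})) - coeff z (?a, insert l (S j - {k})))
             = 0"
          by simp
      qed
    qed (use kn in auto)
    also have "\<dots> = bsign k (S j) * (coeff z (a, S j) - coeff z (?a, S j))"
      using k ak by (simp add: insert_absorb fun_upd_idem)
    finally have "bsign k (S j) * (bsign k (S j) * (coeff z (a, S j) - coeff z (?a, S j))) = 0"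
      by (metis mult_zero_right)
    then have "coeff z (a, S j) - coeff z (?a, S j) = 0"
      unfolding bsign_square .
    with IH show ?case by simp
  qed
  with True show ?thesis by (auto simp: ring_def)
qed

text \<open>Generators of the relative homology of \<open>(Y, X)\<close>. The holes are normalised
  one after another; what is left after subtracting the discs vanishes near all holes and so lives
  in \<open>X\<close>.\<close>

lemma relative_cycle:
  fixes z :: "cube \<Rightarrow>\<^sub>0 'k::field"
  assumes z: "z \<in> chains n Y r"
    and cycle: "\<And>j q. j \<in> H \<Longrightarrow> q \<in> N j \<Longrightarrow> coeff (boundary z) q = 0"
  shows "\<exists>u c. u \<in> chains n Y (Suc r) \<and>
    z - boundary u - (\<Sum>j\<in>{j \<in> H. card (S j) = r}. pscale (c j) (ring_chain j)) \<in> chains n X r"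
proof -
  have "\<exists>u c. u \<in> chains n Y (Suc r) \<and> (\<forall>j\<in>F. \<forall>q\<in>N j.
      coeff (z - boundary u) q = c j * coeff (ring_chain j) q)"
    if "finite F" "F \<subseteq> H" for F
    using that
  proof (induction F)
    case empty
    show ?case using pscale.subspace_0[OF subspace_chains] by auto
  next
    case (insert j F)
    then obtain u c where u: "u \<in> chains n Y (Suc r)"
      and c: "\<And>i q. i \<in> F \<Longrightarrow> q \<in> N i \<Longrightarrow> coeff (z - boundary u) q = c i * coeff (ring_chain i) q"
      by blast
    have j: "j \<in> H" using insert by auto
    let ?z = "z - boundary u"
    have z1: "?z \<in> chains n Y r" by (intro pscale.subspace_diff subspace_chains z
        boundary_in_chains u)
    have bd: "boundary ?z = boundary z" by (simp add: boundary_diff boundary_boundary[OF u])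
    have "\<exists>z'. moves j r ?z z' \<and> tidy j {..<n} z'"
      using cycle[OF j] by (intro tidy_all j z1) (simp add: bd)
    then obtain z' where m: "moves j r ?z z'" and t: "tidy j {..<n} z'" by blast
    have m_j: "coeff z' q = coeff z' (v j, S j) * coeff (ring_chain j) q"
      if "q \<in> N j" for q
      using tidy_multiple_ring[OF j moves_chains[OF m z1] _ t that] cycle[OF j] moves_boundary[OF m]
      by (simp add: bd lookup_ring_chain[OF j])
    obtain w where w: "w \<in> chains n Y (Suc r)" "z' = ?z - boundary w" using m unfolding moves_def
        by blast
    let ?c = "c(j := coeff z' (v j, S j))"
    have "coeff z' q = ?c i * coeff (ring_chain i) q" if "i \<in> insert j F" "q \<in> N i" for i q
    proof (cases "i = j")
      case True
      with m_j[of q] that show ?thesis by simp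
    next
      case False
      with moves_other[OF m _ j False that(2)] c[of i q] that insert.prems show ?thesis by auto
    qed
    moreover have "z' = z - boundary (u + w)" using w by (simp add: boundary_add)
    moreover have "u + w \<in> chains n Y (Suc r)" using u w
        by (intro pscale.subspace_add subspace_chains)
    ultimately show ?case by blast
  qed
  from this[OF finite_H order.refl] obtain u and c :: "'j \<Rightarrow> 'k" where u: "u \<in> chains n Y (Suc r)"
    and c: "\<And>j q. j \<in> H \<Longrightarrow> q \<in> N j \<Longrightarrow> coeff (z - boundary u) q = c j * coeff (ring_chain j) q"
    by blast
  let ?H = "{j \<in> H. card (S j) = r}"
  let ?z = "z - boundary u"
  let ?w = "?z - (\<Sum>j\<in>?H. pscale (c j) (ring_chain j))"
  have zc: "?z \<in> chains n Y r" by (intro pscale.subspace_diff subspace_chains z boundary_in_chains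
      u)
  have "pscale (c j) (ring_chain j) \<in> chains n Y r" if "j \<in> ?H" for j
    using that ring_chain_chains[of j, where 'a='k] pscale.subspace_scale[OF subspace_chains]
        by blast
  then have wc: "?w \<in> chains n Y r"
    by (intro pscale.subspace_diff subspace_chains zc pscale.subspace_sum)
  have "coeff ?w q = 0" if j: "j \<in> H" and q: "q \<in> N j" for j q
  proof -
    have "coeff (ring_chain i) q = (0 :: 'k)" if "i \<in> H" "i \<noteq> j" for i
      using that N_disjoint[OF j that(1)] ring_subset_N[of i] q by (auto simp: lookup_ring_chain)
    then have "(\<Sum>i\<in>?H. c i * coeff (ring_chain i) q) =
        (\<Sum>i\<in>?H. if i = j then c j * coeff (ring_chain j) q else 0)"
      by (intro sum.cong) auto
    also have "\<dots> = c j * coeff (ring_chain j) q"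
    proof (cases "card (S j) = r")
      case True
      then show ?thesis using j finite_H by simp
    next
      case False
      \<comment> \<open>A disc of the wrong dimension cannot occur, since the chain is homogeneous
        of degree \<open>r\<close>.\<close>
      have "c j * coeff (ring_chain j) q = 0"
      proof (rule ccontr)
        assume nz: "c j * coeff (ring_chain j) q \<noteq> 0"
        then have "q \<in> cubes n Y (card (S j))"
          using lookup_chain_nonzero[OF ring_chain_chains[OF j, where 'a='k], of q] by auto
        moreover have "q \<in> cubes n Y r" using lookup_chain_nonzero[OF zc, of q] c[OF j q] nz by simp
        ultimately show False using False by (auto simp: cubes_def)
      qed
      with False show ?thesis using finite_H by simp
    qed
    finally show ?thesis using c[OF j q] by (simp add: lookup_minus lookup_sum)
  qed
  then have "?w \<in> chains n X r"
    using lookup_chain_nonzero[OF wc] by (intro chainsI) (auto simp: X_cubes)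
  with u show ?thesis by blast
qed

text \<open>The sum of the coefficients of the cubes \<open>(a, S j)\<close> with \<open>a \<in> slab j\<close> is a cocycle of the pair
  \<open>(Y, X)\<close> that detects \<open>ring_chain j\<close>.\<close>

definition slab :: "'j \<Rightarrow> point set" where
  "slab j = {a \<in> grid n. \<forall>k<n. if k \<in> S j then a k = v j k else -1 \<le> a k \<and> a k \<le> 1}"

lemma finite_slab:
  assumes j: "j \<in> H"
  shows "finite (slab j)"
proof -
  have "slab j \<subseteq> {a. \<forall>k. (k \<in> {..<n} \<longrightarrow> a k \<in> {-1..1} \<union> v j ` {..<n}) \<and> (k \<notin> {..<n} \<longrightarrow> a k = 0)}"
    by (auto simp: slab_def grid_def not_less)
  then show ?thesis by (rule finite_subset) (intro finite_set_of_finite_funs, auto)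
qed

lemma slab_in_N:
  assumes "j \<in> H" "a \<in> slab j"
  shows "(a, S j) \<in> N j"
  using assms S_subset[OF assms(1)] by (auto simp: slab_def N_iff[OF assms(1)])

text \<open>In a slab direction \<open>l\<close> the two sums differ by a shift, up to cubes
  sticking out of \<open>[-1, 1]\<close> at the ends. Such cubes would be cofaces of slab cubes,
  hence in \<open>N j\<close>, which excludes them: here it matters that the slab crosses all of
  \<open>Y\<close>.\<close>

lemma slab_boundary:
  fixes u :: "cube \<Rightarrow>\<^sub>0 'k::field"
  assumes j: "j \<in> H" and u: "u \<in> chains n Y i"
  shows "(\<Sum>a\<in>slab j. coeff (boundary u) (a, S j)) = 0"
proof -
  have "(\<Sum>a\<in>slab j. coeff (boundary u) (a, S j)) =
     (\<Sum>l\<in>{..<n} - S j. bsign l (S j) * ((\<Sum>a\<in>slab j. coeff u (a(l := a l - 1), insert l (S j))) -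
        (\<Sum>a\<in>slab j. coeff u (a, insert l (S j)))))"
    unfolding lookup_boundary_chain[OF u]
    by (subst sum.swap) (simp only: sum_distrib_left sum_subtractf right_diff_distrib)
  also have "\<dots> = 0"
  proof (rule sum.neutral, rule ballI)
    fix l assume "l \<in> {..<n} - S j"
    then have l: "l < n" "l \<notin> S j" by auto
    have top: "coeff u (a, insert l (S j)) = 0" if "a \<in> slab j" "a l = 1" for a
    proof (rule ccontr)
      assume nz: "coeff u (a, insert l (S j)) \<noteq> 0"
      have "(a, insert l (S j)) \<in> N j"
        by (rule N_coface(1)[OF j slab_in_N[OF j that(1)] l(2) lookup_chain_nonzero[OF u nz]])
      then show False using l that(2) by (auto simp: N_iff[OF j])
    qed
    have bot: "coeff u (a(l := a l - 1), insert l (S j)) = 0" if "a \<in> slab j" "a l = -1" for a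
    proof (rule ccontr)
      assume nz: "coeff u (a(l := a l - 1), insert l (S j)) \<noteq> 0"
      have "(a(l := a l - 1), insert l (S j)) \<in> N j"
        by (rule N_coface(2)[OF j slab_in_N[OF j that(1)] l(2) lookup_chain_nonzero[OF u nz]])
      then show False using l that(2) by (auto simp: N_iff[OF j])
    qed
    have "(\<Sum>a\<in>slab j. coeff u (a(l := a l - 1), insert l (S j))) =
        (\<Sum>a\<in>{a \<in> slab j. a l \<noteq> -1}. coeff u (a(l := a l - 1), insert l (S j)))"
      using bot finite_slab[OF j] by (intro sum.mono_neutral_right) auto
    also have "\<dots> = (\<Sum>a\<in>{a \<in> slab j. a l \<noteq> 1}. coeff u (a, insert l (S j)))"
      by (rule sum.reindex_bij_witness[of _ "\<lambda>a. a(l := a l + 1)" "\<lambda>a. a(l := a l - 1)"])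
        (use l in \<open>auto simp: slab_def grid_def\<close>)
    also have "\<dots> = (\<Sum>a\<in>slab j. coeff u (a, insert l (S j)))"
      using top finite_slab[OF j] by (intro sum.mono_neutral_left) auto
    finally show "bsign l (S j) * ((\<Sum>a\<in>slab j. coeff u (a(l := a l - 1), insert l (S j))) -
        (\<Sum>a\<in>slab j. coeff u (a, insert l (S j)))) = 0" by simp
  qed
  finally show ?thesis .
qed

lemma slab_ring_chain:
  assumes j: "j \<in> H" and i: "i \<in> H"
  shows "(\<Sum>a\<in>slab j. coeff (ring_chain i) (a, S j)) = (of_bool (i = j) :: 'a::field)"
proof (cases "i = j")
  case True
  have "(a, S j) \<in> ring j \<longleftrightarrow> a = v j" if a: "a \<in> slab j" for a
  proof
    assume r: "(a, S j) \<in> ring j"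
    have "a k = v j k" for k
    proof (cases "k < n")
      case True
      then show ?thesis using a r v_slab[OF j True]
          by (cases "k \<in> S j") (auto simp: ring_def slab_def)
    next
      case False
      then show ?thesis using a v_grid[OF j] by (auto simp: slab_def grid_def)
    qed
    then show "a = v j" by auto
  next
    assume "a = v j"
    then show "(a, S j) \<in> ring j" using v_grid[OF j] v_slab[OF j] by (auto simp: ring_def)
  qed
  then have "(\<Sum>a\<in>slab j. coeff (ring_chain i) (a, S j)) = (\<Sum>a\<in>slab j. if a = v j then 1 else 0)"
    using True by (intro sum.cong refl) (simp add: lookup_ring_chain[OF j])
  moreover have "v j \<in> slab j" using v_grid[OF j] v_slab[OF j] by (auto simp: slab_def)
  ultimately show ?thesis using True finite_slab[OF j] by simp
next
  case False
  have "coeff (ring_chain i) (a, S j) = (0 :: 'a)" if "a \<in> slab j" for a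
    using slab_in_N[OF j that] N_disjoint[OF j i] False ring_subset_N[OF i]
        by (auto simp: lookup_ring_chain[OF i])
  with False show ?thesis by simp
qed

text \<open>The connecting isomorphism of the pair \<open>(Y, X)\<close> made explicit: the
  boundaries of the discs of dimension \<open>i + 1\<close> form a basis. A cycle of
  \<open>X\<close> is first filled in \<open>Y\<close>, and the filling is a relative cycle.\<close>

theorem betti_punctured:
  assumes Y: "pos_acyclic TYPE('k::field) n Y" and i: "0 < i"
  shows "betti TYPE('k) n X i = card {j \<in> H. card (S j) = Suc i}"
proof -
  let ?H = "{j \<in> H. card (S j) = Suc i}"
  let ?b = "\<lambda>j. boundary (ring_chain j) :: cube \<Rightarrow>\<^sub>0 'k"
  have XY: "chains n X r \<subseteq> chains n Y r" for r
    by (auto simp: chains_def X_cubes)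
  have indep: "c j = 0" if c: "(\<Sum>j\<in>?H. pscale (c j) (?b j)) \<in> boundaries n X i" and j: "j \<in> ?H"
      for c j
  proof -
    let ?q = "\<Sum>j\<in>?H. pscale (c j) (ring_chain j) :: cube \<Rightarrow>\<^sub>0 'k"
    obtain w where w: "w \<in> chains n X (Suc i)" "(\<Sum>j\<in>?H. pscale (c j) (?b j)) = boundary w"
      using c by (auto simp: boundaries_def)
    \<comment> \<open>A relation among the spheres closes up to the cycle \<open>?q - w\<close> of
      \<open>Y\<close>, which is a boundary. Summing its coefficients over \<open>slab j\<close>
      gives 0 on the one hand; on the other hand \<open>w\<close> contributes nothing and the discs
      contribute \<open>c j\<close>.\<close>
    have "boundary (?q - w) = 0"
      using w(2) by (simp add: boundary_diff boundary_sum boundary_pscale)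
    moreover have "pscale (c j) (ring_chain j) \<in> chains n Y (Suc i)" if "j \<in> ?H" for j
      using that ring_chain_chains[of j, where 'a='k] pscale.subspace_scale[OF subspace_chains]
          by auto
    then have "?q - w \<in> chains n Y (Suc i)"
      using w(1) XY by (intro pscale.subspace_diff pscale.subspace_sum subspace_chains) auto
    ultimately have "?q - w \<in> cycles n Y (Suc i)" by (simp add: cycles_def)
    with Y obtain u where u: "u \<in> chains n Y (Suc (Suc i))" "?q - w = boundary u"
      unfolding pos_acyclic_def boundaries_def by blast
    have jH: "j \<in> H" using j by simp
    have "coeff w (a, S j) = 0" if "a \<in> slab j" for a
      using slab_in_N[OF jH that] lookup_chain_nonzero[OF w(1)] jH unfolding X_cubes by blast
    then have "(\<Sum>a\<in>slab j. coeff (?q - w) (a, S j)) =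
        (\<Sum>a\<in>slab j. \<Sum>i\<in>?H. c i * coeff (ring_chain i) (a, S j))"
      by (simp add: lookup_minus lookup_sum)
    also have "\<dots> = (\<Sum>i\<in>?H. c i * (\<Sum>a\<in>slab j. coeff (ring_chain i) (a, S j)))"
      by (subst sum.swap) (simp add: sum_distrib_left)
    also have "\<dots> = (\<Sum>i\<in>?H. if i = j then c j else 0)"
      by (intro sum.cong refl) (auto simp: slab_ring_chain[OF jH])
    also have "\<dots> = c j" using j finite_H by simp
    finally show "c j = 0" using slab_boundary[OF jH u(1)] u(2) by simp
  qed
  have inj: "inj_on ?b ?H"
  proof (rule inj_onI, rule ccontr)
    fix j j' assume jj: "j \<in> ?H" "j' \<in> ?H" "?b j = ?b j'" "j \<noteq> j'"
    let ?c = "\<lambda>l. (if l = j then 1 else 0) - (if l = j' then 1 else 0) :: 'k"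
    have "(\<Sum>l\<in>?H. pscale (?c l) (?b l)) = 0"
      using jj finite_H
      by (simp add: pscale.scale_left_diff_distrib sum_subtractf if_distrib[of "\<lambda>x. pscale x _"]
          cong: if_cong)
    then have "(\<Sum>l\<in>?H. pscale (?c l) (?b l)) \<in> boundaries n X i"
      using pscale.subspace_0[OF subspace_boundaries] by simp
    from indep[OF this jj(1)] jj(4) show False by simp
  qed
  have "quotient_basis pscale (cycles n X i) (boundaries n X i) (?b ` ?H)"
    unfolding quotient_basis_def
  proof (intro conjI allI impI ballI)
    show "finite (?b ` ?H)" using finite_H by simp
    show "?b ` ?H \<subseteq> cycles n X i"
    proof (intro image_subsetI)
      fix j assume j: "j \<in> ?H"
      have c: "?b j \<in> chains n Y i" using ring_chain_chains[of j, where 'a='k] j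
          by (intro boundary_in_chains) auto
      have "?b j \<in> chains n X i"
        using lookup_chain_nonzero[OF c] boundary_ring_chain[of j, where 'a='k] j
        by (intro chainsI) (auto simp: X_cubes)
      moreover have "boundary (?b j) = 0"
        using ring_chain_chains[of j, where 'a='k] j by (intro boundary_boundary) auto
      ultimately show "?b j \<in> cycles n X i" by (simp add: cycles_def)
    qed
  next
    fix z :: "cube \<Rightarrow>\<^sub>0 'k" assume "z \<in> cycles n X i"
    then have z: "z \<in> chains n X i" "boundary z = 0" by (auto simp: cycles_def)
    then have "z \<in> cycles n Y i" using XY by (auto simp: cycles_def)
    with Y i obtain w where w: "w \<in> chains n Y (Suc i)" "z = boundary w"
      unfolding pos_acyclic_def boundaries_def by blast
    have "coeff (boundary w) q = 0" if "j \<in> H" "q \<in> N j" for j q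
      using lookup_chain_nonzero[OF z(1), of q] w(2) that by (auto simp: X_cubes)
    then have "\<exists>u c. u \<in> chains n Y (Suc (Suc i)) \<and>
      w - boundary u - (\<Sum>j\<in>?H. pscale (c j) (ring_chain j)) \<in> chains n X (Suc i)"
      by (rule relative_cycle[OF w(1)])
    then obtain u c where u: "u \<in> chains n Y (Suc (Suc i))"
      and c: "w - boundary u - (\<Sum>j\<in>?H. pscale (c j) (ring_chain j)) \<in> chains n X (Suc i)" by blast
    have "boundary (w - boundary u - (\<Sum>j\<in>?H. pscale (c j) (ring_chain j))) =
        z - (\<Sum>j\<in>?H. pscale (c j) (?b j))"
      using w(2) by (simp add: boundary_diff boundary_boundary[OF u] boundary_sum boundary_pscale)
    also have "(\<Sum>j\<in>?H. pscale (c j) (?b j)) = (\<Sum>s\<in>?b ` ?H. pscale (c (the_inv_into ?H ?b s)) s)"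
      by (rule sum.reindex_cong[OF inj refl, symmetric]) (simp only: the_inv_into_f_f[OF inj])
    finally have "z - (\<Sum>s\<in>?b ` ?H. pscale (c (the_inv_into ?H ?b s)) s) \<in> boundaries n X i"
      unfolding boundaries_def using c by (intro image_eqI[OF _ c]) (rule sym)
    then show "\<exists>c. z - (\<Sum>s\<in>?b ` ?H. pscale (c s) s) \<in> boundaries n X i"
      by (rule exI[of _ "\<lambda>s. c (the_inv_into ?H ?b s)"])
  next
    fix c s assume c: "(\<Sum>s\<in>?b ` ?H. pscale (c s) s) \<in> boundaries n X i" and s: "s \<in> ?b ` ?H"
    have "(\<Sum>j\<in>?H. pscale (c (?b j)) (?b j)) \<in> boundaries n X i"
      using c by (simp add: sum.reindex[OF inj])
    then show "c s = 0" using indep[of "\<lambda>j. c (?b j)"] s by auto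
  qed
  then have "quotient_dim pscale (cycles n X i) (boundaries n X i :: (cube \<Rightarrow>\<^sub>0 'k) set) =
      card (?b ` ?H)"
    by (intro quotient_dim_eq_card vector_space_pscale subspace_boundaries)
  then show ?thesis by (simp add: betti_def card_image[OF inj])
qed

end

section \<open>Glued interval modules\<close>

lemma span_singles:
  assumes "finite D"
  shows "pscale.span ((\<lambda>j. single j 1) ` D) = {v :: 'i \<Rightarrow>\<^sub>0 'k::field. keys v \<subseteq> D}"
proof (intro antisym subsetI)
  fix v :: "'i \<Rightarrow>\<^sub>0 'k" assume "v \<in> pscale.span ((\<lambda>j. single j 1) ` D)"
  moreover have "pscale.span ((\<lambda>j. single j 1) ` D) \<subseteq> {v :: 'i \<Rightarrow>\<^sub>0 'k. keys v \<subseteq> D}"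
    by (rule pscale.span_minimal[OF _ subspace_keys]) auto
  ultimately show "v \<in> {v. keys v \<subseteq> D}" by blast
next
  fix v :: "'i \<Rightarrow>\<^sub>0 'k" assume v: "v \<in> {v. keys v \<subseteq> D}"
  have "v = (\<Sum>j\<in>D. pscale (coeff v j) (single j 1))"
    using v assms by (intro poly_mapping_eqI) (auto simp: lookup_sum lookup_single when_def
        in_keys_iff if_distrib cong: if_cong)
  also have "\<dots> \<in> pscale.span ((\<lambda>j. single j 1) ` D)"
    by (intro pscale.span_sum pscale.span_scale pscale.span_base) auto
  finally show "v \<in> pscale.span ((\<lambda>j. single j 1) ` D)" .
qed

lemma pscale_single: "pscale c (single j a) = single j (c * a)"
  by (intro poly_mapping_eqI) (simp add: lookup_single when_def)

lemma linear_on_zero: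
  assumes "linear_on s t V f" "0 \<in> V"
  shows "f 0 = 0"
proof -
  have "f (0 + 0) = f 0 + f 0" using assms unfolding linear_on_def by blast
  then show ?thesis by simp
qed

lemma persistence_module_zero:
  assumes "persistence_module pscale n W" "x \<in> grid n"
  shows "0 \<in> pspace W x"
  using assms pscale.span_zero unfolding persistence_module_def by metis

locale glued =
  fixes n :: nat and I :: "nat set" and h :: nat and P :: "nat \<Rightarrow> point set" and p :: "nat \<Rightarrow> point"
    and G :: "point set"
  assumes finite_I: "finite I" and h: "h \<in> I"
    and P_grid: "i \<in> I \<Longrightarrow> P i \<subseteq> grid n"
    and p_in: "i \<in> I \<Longrightarrow> p i \<in> P i"
    and p_le: "i \<in> I \<Longrightarrow> x \<in> P i \<Longrightarrow> p i \<le> x"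
    and convex: "i \<in> I \<Longrightarrow> x \<in> P i \<Longrightarrow> y \<in> grid n \<Longrightarrow> p i \<le> y \<Longrightarrow> y \<le> x \<Longrightarrow> y \<in> P i"
    and separate: "i \<in> I \<Longrightarrow> j \<in> I \<Longrightarrow> i \<noteq> j \<Longrightarrow> p i \<notin> P j"
    and G_hub: "G \<subseteq> P h"
    and maximal: "g \<in> G \<Longrightarrow> i \<in> I \<Longrightarrow> g \<in> P i \<Longrightarrow> y \<in> P i \<Longrightarrow> g \<le> y \<Longrightarrow> y = g"
    and p_not_G: "i \<in> I \<Longrightarrow> p i \<notin> G"
    and meets_G: "i \<in> I \<Longrightarrow> i \<noteq> h \<Longrightarrow> G \<inter> P i \<noteq> {}"
begin

text \<open>At a point of \<open>G\<close>, the generator \<open>h\<close> represents all identified summands.\<close>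

definition idx :: "point \<Rightarrow> nat \<Rightarrow> nat" where
  "idx x i = (if x \<in> G then h else i)"

text \<open>At a point of \<open>G\<close> the sum adds all coordinates into coordinate
  \<open>h\<close>, which is the quotient map of the identification. Out of such a point every
  transition to a larger point is zero by maximality. The separate case \<open>x = y\<close> makes
  the identity law hold for all vectors.\<close>

definition glue_module :: "(nat \<Rightarrow>\<^sub>0 'k::field) pmod" where
  "glue_module =
     \<lparr> pspace = (\<lambda>x. {v. keys v \<subseteq> idx x ` {i\<in>I. x \<in> P i}}),
       ptrans = (\<lambda>x y v. if x = y then v else
         (\<Sum>i\<in>{i\<in>I. x \<in> P i \<and> y \<in> P i}. single (idx y i) (coeff v i))) \<rparr>"

lemma pspace_span:
  "pspace glue_module x = pscale.span ((\<lambda>j. single j 1) ` idx x ` {i\<in>I. x \<in> P i})"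
  by (subst span_singles) (auto simp: glue_module_def finite_I)

lemma ptrans_neq: "x \<noteq> y \<Longrightarrow> ptrans glue_module x y v =
  (\<Sum>i\<in>{i\<in>I. x \<in> P i \<and> y \<in> P i}. single (idx y i) (coeff v i))"
  by (simp add: glue_module_def)

lemma ptrans_into:
  assumes "v \<in> pspace glue_module x"
  shows "ptrans glue_module x y v \<in> pspace glue_module y"
proof (cases "x = y")
  case False
  have "single (idx y i) c \<in> pspace glue_module y" if "i \<in> I" "y \<in> P i" for i c
    using that by (auto simp: glue_module_def)
  then show ?thesis
    using False unfolding ptrans_neq[OF False] by (auto simp: pspace_span intro!: pscale.span_sum)
qed (use assms in \<open>simp add: glue_module_def\<close>)

lemma ptrans_linear: "linear_on pscale pscale V (ptrans glue_module x y)"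
proof (cases "x = y")
  case False
  show ?thesis
    unfolding linear_on_def ptrans_neq[OF False]
    by (simp add: lookup_add single_add sum.distrib pscale.scale_sum_right pscale_single)
qed (simp add: linear_on_def glue_module_def)

text \<open>By convexity an interval containing \<open>x\<close> and \<open>z\<close> contains
  \<open>y\<close>, so no summand is lost on the way. If \<open>y\<close> is a gluing point,
  maximality leaves no interval containing \<open>y\<close> and \<open>z\<close>, and both sides are
  zero.\<close>

lemma ptrans_comp:
  assumes xyz: "x \<le> y" "y \<le> z" and y: "y \<in> grid n"
  shows "ptrans glue_module y z (ptrans glue_module x y v) = ptrans glue_module x z v"
proof (cases "x = y \<or> y = z")
  case True
  then show ?thesis by (auto simp: glue_module_def)
next
  case False
  then have neq: "x \<noteq> y" "y \<noteq> z" "x \<noteq> z" using xyz by auto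
  have between: "y \<in> P i" if "i \<in> I" "x \<in> P i" "z \<in> P i" for i
    using that convex[of i z y] p_le[of i x] xyz y order_trans by blast
  show ?thesis
  proof (cases "y \<in> G")
    case True
    then have "{i \<in> I. y \<in> P i \<and> z \<in> P i} = {}" using maximal[of y _ z] xyz neq by auto
    moreover from this have "{i \<in> I. x \<in> P i \<and> z \<in> P i} = {}" using between by blast
    ultimately show ?thesis unfolding ptrans_neq[OF neq(2)] ptrans_neq[OF neq(3)]
        by (simp only: sum.empty)
  next
    case False
    have "coeff (ptrans glue_module x y v) i = (if x \<in> P i then coeff v i else 0)"
      if "i \<in> I" "y \<in> P i" for i
      using that finite_I False by (simp add: ptrans_neq[OF neq(1)] idx_def lookup_sum
          lookup_single when_def)
    then have "ptrans glue_module y z (ptrans glue_module x y v) =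
      (\<Sum>i\<in>{i\<in>I. y \<in> P i \<and> z \<in> P i}. if x \<in> P i then single (idx z i) (coeff v i) else 0)"
      unfolding ptrans_neq[OF neq(2)] by (intro sum.cong) auto
    also have "\<dots> = (\<Sum>i\<in>{i\<in>I. x \<in> P i \<and> z \<in> P i}. single (idx z i) (coeff v i))"
      using finite_I between by (intro sum.mono_neutral_cong_right) auto
    finally show ?thesis unfolding ptrans_neq[OF neq(3)] .
  qed
qed

lemma persistence_module_glue_module: "persistence_module pscale n glue_module"
  unfolding persistence_module_def
proof (intro conjI ballI impI)
  fix x assume "x \<in> grid n"
  show "\<exists>B. finite B \<and> pspace glue_module x = pscale.span B"
    by (rule exI[of _ "(\<lambda>j. single j 1) ` idx x ` {i\<in>I. x \<in> P i}"])
      (simp add: pspace_span finite_I)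
next
  fix x y
  show "ptrans glue_module x y ` pspace glue_module x \<subseteq> pspace glue_module y"
    using ptrans_into by (rule image_subsetI)
next
  fix x y
  show "linear_on pscale pscale (pspace glue_module x) (ptrans glue_module x y)"
      by (rule ptrans_linear)
next
  fix x and v :: "nat \<Rightarrow>\<^sub>0 'a"
  show "ptrans glue_module x x v = v" by (simp add: glue_module_def)
next
  fix x y z and v :: "nat \<Rightarrow>\<^sub>0 'a" assume "x \<le> y" "y \<le> z" "y \<in> grid n"
  then show "ptrans glue_module y z (ptrans glue_module x y v) = ptrans glue_module x z v"
    by (rule ptrans_comp)
qed

lemma support_glue_module: "pmod_support n (glue_module :: (nat \<Rightarrow>\<^sub>0 'k::field) pmod) = (\<Union>i\<in>I. P i)"
proof -
  have "pspace (glue_module :: (nat \<Rightarrow>\<^sub>0 'k) pmod) x \<noteq> {0} \<longleftrightarrow> (\<exists>i\<in>I. x \<in> P i)" for x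
  proof
    assume "pspace (glue_module :: (nat \<Rightarrow>\<^sub>0 'k) pmod) x \<noteq> {0}"
    moreover have "pspace (glue_module :: (nat \<Rightarrow>\<^sub>0 'k) pmod) x = {0}" if "{i \<in> I. x \<in> P i} = {}"
      unfolding pspace_span that by simp
    ultimately show "\<exists>i\<in>I. x \<in> P i" by blast
  next
    assume "\<exists>i\<in>I. x \<in> P i"
    then obtain i where "i \<in> I" "x \<in> P i" by blast
    then have "single (idx x i) 1 \<in> pspace (glue_module :: (nat \<Rightarrow>\<^sub>0 'k) pmod) x"
      by (auto simp: glue_module_def)
    moreover have "single (idx x i) (1::'k) \<noteq> 0"
      by (metis lookup_single_eq lookup_zero zero_neq_one)
    ultimately show "pspace (glue_module :: (nat \<Rightarrow>\<^sub>0 'k) pmod) x \<noteq> {0}" by blast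
  qed
  then show ?thesis using P_grid by (auto simp: pmod_support_def)
qed

section \<open>Generators and indecomposability\<close>

lemma pspace_p:
  assumes "i \<in> I"
  shows "pspace glue_module (p i) = {v. keys v \<subseteq> {i}}"
proof -
  have "{j \<in> I. p i \<in> P j} = {i}" using assms p_in separate by blast
  then show ?thesis using p_not_G[OF assms] by (simp add: glue_module_def idx_def)
qed

lemma ptrans_p:
  assumes i: "i \<in> I" and x: "x \<in> P i"
  shows "ptrans glue_module (p i) x (single i c) = single (idx x i) c"
proof (cases "p i = x")
  case True
  then show ?thesis using p_not_G[OF i] by (simp add: glue_module_def idx_def)
next
  case False
  have "{j \<in> I. p i \<in> P j \<and> x \<in> P j} = {i}" using i x p_in separate by blast
  then show ?thesis by (simp add: ptrans_neq[OF False])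
qed

text \<open>The space at \<open>p i\<close> is a line, so the projection to \<open>W\<close> acts on
  it by a scalar \<open>c\<close>. If the generator corresponds to \<open>(w, w')\<close>, then
  \<open>c\<close> times this pair is \<open>(w, 0)\<close>; either \<open>w' = 0\<close>, or
  \<open>c = 0\<close> and hence \<open>w = 0\<close>.\<close>

lemma component_zero:
  fixes \<phi> :: "point \<Rightarrow> (nat \<Rightarrow>\<^sub>0 'k::field) \<Rightarrow> (nat \<Rightarrow>\<^sub>0 'k) \<times> (nat \<Rightarrow>\<^sub>0 'k)"
  assumes i: "i \<in> I" and W': "persistence_module pscale n W'"
    and lin: "\<And>x. x \<in> grid n \<Longrightarrow> linear_on pscale (prod_scale pscale pscale) (pspace glue_module x)
        (\<phi> x)"
    and bij: "\<And>x. x \<in> grid n \<Longrightarrow> bij_betw (\<phi> x) (pspace glue_module x) (pspace W x \<times> pspace W' x)"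
  shows "fst (\<phi> (p i) (single i 1)) = 0 \<or> snd (\<phi> (p i) (single i 1)) = 0"
proof -
  let ?e = "single i (1::'k)"
  have pg: "p i \<in> grid n" using i p_in P_grid by blast
  obtain w w' where w: "\<phi> (p i) ?e = (w, w')" by force
  have img: "\<phi> (p i) ` pspace glue_module (p i) = pspace W (p i) \<times> pspace W' (p i)"
    using bij[OF pg] by (simp add: bij_betw_def)
  have e: "?e \<in> pspace glue_module (p i)" using i by (simp add: pspace_p)
  with img w have "w \<in> pspace W (p i)" by (metis SigmaD1 imageI)
  then have "(w, 0) \<in> pspace W (p i) \<times> pspace W' (p i)"
    using persistence_module_zero[OF W' pg] by simp
  then obtain v where v: "v \<in> pspace glue_module (p i)" "\<phi> (p i) v = (w, 0)"
    using img by (metis imageE)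
  then have "v = pscale (coeff v i) ?e"
    using i by (intro poly_mapping_eqI) (auto simp: pspace_p lookup_single when_def in_keys_iff)
  then have "\<phi> (p i) v = prod_scale pscale pscale (coeff v i) (\<phi> (p i) ?e)"
    using lin[OF pg] e unfolding linear_on_def by metis
  then have "pscale (coeff v i) w' = 0" "pscale (coeff v i) w = w"
    using v w by (auto simp: prod_scale_def)
  then show ?thesis using w by auto
qed

text \<open>A generator with a component in \<open>W'\<close> has none in \<open>W\<close>, while
  the generator \<open>h\<close> has none in \<open>W'\<close>. At a common gluing point both have
  the same nonzero image, which would then lie in both summands. So no generator reaches
  \<open>W'\<close>.\<close>

lemma summand_zero:
  fixes \<phi> :: "point \<Rightarrow> (nat \<Rightarrow>\<^sub>0 'k::field) \<Rightarrow> (nat \<Rightarrow>\<^sub>0 'k) \<times> (nat \<Rightarrow>\<^sub>0 'k)"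
  assumes W: "persistence_module pscale n W" and W': "persistence_module pscale n W'"
    and lin: "\<And>x. x \<in> grid n \<Longrightarrow> linear_on pscale (prod_scale pscale pscale) (pspace glue_module x)
        (\<phi> x)"
    and bij: "\<And>x. x \<in> grid n \<Longrightarrow> bij_betw (\<phi> x) (pspace glue_module x) (pspace W x \<times> pspace W' x)"
    and nat: "\<And>x y v. x \<in> grid n \<Longrightarrow> y \<in> grid n \<Longrightarrow> x \<le> y \<Longrightarrow> v \<in> pspace glue_module x \<Longrightarrow>
      \<phi> y (ptrans glue_module x y v) = map_prod (ptrans W x y) (ptrans W' x y) (\<phi> x v)"
    and hub: "snd (\<phi> (p h) (single h 1)) = 0"
  shows "pmod_zero n W'"
proof -
  let ?e = "\<lambda>i. single i (1::'k)"
  have pg: "p i \<in> grid n" if "i \<in> I" for i using that p_in P_grid by blast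
  have zero: "ptrans U x y 0 = 0" if "persistence_module pscale n U" "x \<in> grid n" "y \<in> grid n" "x
      \<le> y"
    for U :: "(nat \<Rightarrow>\<^sub>0 'k) pmod" and x y
  proof -
    have "linear_on pscale pscale (pspace U x) (ptrans U x y)"
      using that by (simp add: persistence_module_def)
    then show ?thesis using persistence_module_zero[OF that(1,2)] by (rule linear_on_zero)
  qed
  have transport: "\<phi> x (?e (idx x i)) =
      (ptrans W (p i) x (fst (\<phi> (p i) (?e i))), ptrans W' (p i) x (snd (\<phi> (p i) (?e i))))"
    if "i \<in> I" "x \<in> P i" for i x
  proof -
    have "x \<in> grid n" using that P_grid by blast
    then have "\<phi> x (ptrans glue_module (p i) x (?e i)) =
        map_prod (ptrans W (p i) x) (ptrans W' (p i) x) (\<phi> (p i) (?e i))"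
      using that pg p_le by (intro nat) (auto simp: pspace_p)
    then show ?thesis by (simp add: ptrans_p[OF that] map_prod_def case_prod_beta)
  qed
  have all: "snd (\<phi> (p i) (?e i)) = 0" if i: "i \<in> I" for i
  proof (rule ccontr)
    assume nz: "snd (\<phi> (p i) (?e i)) \<noteq> 0"
    with hub have "i \<noteq> h" by blast
    then obtain g where g: "g \<in> G" "g \<in> P i" using meets_G[OF i] by blast
    have gh: "g \<in> P h" using g G_hub by blast
    have gg: "g \<in> grid n" using g P_grid i by blast
    have "\<phi> g (?e h) = (ptrans W (p i) g (fst (\<phi> (p i) (?e i))), ptrans W' (p i) g (snd (\<phi> (p i)
        (?e i))))"
      using transport[OF i g(2)] g(1) by (simp add: idx_def)
    moreover have "\<phi> g (?e h) = (ptrans W (p h) g (fst (\<phi> (p h) (?e h))), ptrans W' (p h) g (snd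
        (\<phi> (p h) (?e h))))"
      using transport[OF h gh] g(1) by (simp add: idx_def)
    \<comment> \<open>The first description has first component zero, the second one has second
      component zero.\<close>
    ultimately have "\<phi> g (?e h) = (0, 0)"
      using component_zero[OF i W' lin bij] nz hub zero[OF W pg[OF i] gg p_le[OF i g(2)]] zero[OF
          W' pg[OF h] gg p_le[OF h gh]] by auto
    moreover have "\<phi> g 0 = 0"
      by (rule linear_on_zero[OF lin[OF gg]]) (simp add: glue_module_def)
    ultimately have "\<phi> g (?e h) = \<phi> g 0" by (simp add: zero_prod_def)
    moreover have "?e h \<in> pspace glue_module g" "0 \<in> pspace (glue_module :: (nat \<Rightarrow>\<^sub>0 'k) pmod) g"
      using g gh h by (auto simp: glue_module_def idx_def)
    ultimately have "?e h = 0" using bij[OF gg] by (metis bij_betw_imp_inj_on inj_onD)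
    then show False by (metis lookup_single_eq lookup_zero zero_neq_one)
  qed
  show ?thesis
    unfolding pmod_zero_def
  proof
    fix x assume x: "x \<in> grid n"
    have img: "\<phi> x ` pspace glue_module x = pspace W x \<times> pspace W' x"
      using bij[OF x] by (simp add: bij_betw_def)
    have gen: "snd (\<phi> x (?e j)) = 0" if "j \<in> idx x ` {i\<in>I. x \<in> P i}" for j
      using that transport all zero[OF W' pg x p_le] by auto
    have snd0: "snd (\<phi> x v) = 0" if "v \<in> pspace glue_module x" for v
    proof -
      let ?M = "pspace (glue_module :: (nat \<Rightarrow>\<^sub>0 'k) pmod) x"
      have "v \<in> {v \<in> ?M. snd (\<phi> x v) = 0}"
      proof (rule pscale.span_induct_alt[of v "?e ` idx x ` {i\<in>I. x \<in> P i}" "\<lambda>v. v \<in> {v \<in> ?M. snd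
          (\<phi> x v) = 0}"])
        show "v \<in> pscale.span (?e ` idx x ` {i\<in>I. x \<in> P i})" using that by (simp add: pspace_span)
        have "\<phi> x 0 = 0"
          by (rule linear_on_zero[OF lin[OF x]]) (simp add: glue_module_def)
        then show "0 \<in> {v \<in> ?M. snd (\<phi> x v) = 0}" by (simp add: glue_module_def)
        fix c b y assume b: "b \<in> ?e ` idx x ` {i\<in>I. x \<in> P i}" and y: "y \<in> {v \<in> ?M. snd (\<phi> x v) = 0}"
        have bM: "b \<in> ?M" unfolding pspace_span by (rule pscale.span_base[OF b])
        then have cM: "pscale c b \<in> ?M" unfolding pspace_span by (rule pscale.span_scale)
        with y have "pscale c b + y \<in> ?M" unfolding pspace_span using pscale.span_add by blast
        moreover have "\<phi> x (pscale c b + y) = prod_scale pscale pscale c (\<phi> x b) + \<phi> x y"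
          using lin[OF x] bM cM y unfolding linear_on_def by auto
        moreover have "snd (\<phi> x b) = 0" using b gen by auto
        ultimately show "pscale c b + y \<in> {v \<in> ?M. snd (\<phi> x v) = 0}" using y
            by (simp add: prod_scale_def)
      qed
      then show ?thesis by simp
    qed
    have "u = 0" if "u \<in> pspace W' x" for u
    proof -
      have "(0, u) \<in> \<phi> x ` pspace glue_module x"
        unfolding img using that persistence_module_zero[OF W x] by simp
      then obtain v where "v \<in> pspace glue_module x" "\<phi> x v = (0, u)" by (metis imageE)
      then show ?thesis using snd0[of v] by simp
    qed
    then show "pspace W' x = {0}" using persistence_module_zero[OF W' x] by auto
  qed
qed

lemma indecomposable_glue_module: "pmod_indecomposable pscale n (glue_module :: (nat \<Rightarrow>\<^sub>0
    'k::field) pmod)"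
  unfolding pmod_indecomposable_def
proof (intro conjI allI impI)
  have "p h \<in> pmod_support n (glue_module :: (nat \<Rightarrow>\<^sub>0 'k) pmod)"
    using h p_in by (auto simp: support_glue_module)
  then show "\<not> pmod_zero n (glue_module :: (nat \<Rightarrow>\<^sub>0 'k) pmod)"
    by (auto simp: pmod_zero_def pmod_support_def)
next
  fix W W' :: "(nat \<Rightarrow>\<^sub>0 'k) pmod"
  assume W: "persistence_module pscale n W" and W': "persistence_module pscale n W'"
    and iso: "pmod_iso pscale (prod_scale pscale pscale) n glue_module (pmod_sum W W')"
  obtain \<phi> where \<phi>: "\<forall>x\<in>grid n. linear_on pscale (prod_scale pscale pscale) (pspace glue_module x)
      (\<phi> x) \<and>
      bij_betw (\<phi> x) (pspace glue_module x) (pspace (pmod_sum W W') x)"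
    "\<forall>x\<in>grid n. \<forall>y\<in>grid n. x \<le> y \<longrightarrow> (\<forall>v\<in>pspace glue_module x.
      \<phi> y (ptrans glue_module x y v) = ptrans (pmod_sum W W') x y (\<phi> x v))"
    using iso unfolding pmod_iso_def by (elim exE conjE) (rule that)
  have lin: "linear_on pscale (prod_scale pscale pscale) (pspace glue_module x) (\<phi> x)"
    and bij: "bij_betw (\<phi> x) (pspace glue_module x) (pspace W x \<times> pspace W' x)" if "x \<in> grid n"
        for x
    using \<phi>(1) that by (auto simp: pmod_sum_def)
  have nat: "\<phi> y (ptrans glue_module x y v) = map_prod (ptrans W x y) (ptrans W' x y) (\<phi> x v)"
    if "x \<in> grid n" "y \<in> grid n" "x \<le> y" "v \<in> pspace glue_module x" for x y v
    using \<phi>(2) that by (simp add: pmod_sum_def)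
  \<comment> \<open>Swapping the summands reduces the case of a zero first component to that of a
    zero second one.\<close>
  let ?e = "single h (1::'k)" and ?\<psi> = "\<lambda>x v. prod.swap (\<phi> x v)"
  have ph: "p h \<in> grid n" using h p_in P_grid by blast
  have lin': "linear_on pscale (prod_scale pscale pscale) (pspace glue_module x) (?\<psi> x)"
      if "x \<in> grid n" for x
    using lin[OF that] unfolding linear_on_def by (auto simp: prod_scale_def prod_eq_iff)
  have bij': "bij_betw (?\<psi> x) (pspace glue_module x) (pspace W' x \<times> pspace W x)" if "x \<in> grid n"
      for x
  proof -
    have "bij_betw prod.swap (pspace W x \<times> pspace W' x) (pspace W' x \<times> pspace W x)"
      by (auto simp: bij_betw_def inj_on_def)
    from bij_betw_trans[OF bij[OF that] this] show ?thesis by (simp add: comp_def)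
  qed
  have nat': "?\<psi> y (ptrans glue_module x y v) = map_prod (ptrans W' x y) (ptrans W x y) (?\<psi> x v)"
    if "x \<in> grid n" "y \<in> grid n" "x \<le> y" "v \<in> pspace glue_module x" for x y v
    using nat[OF that] by (simp add: prod_eq_iff)
  have "fst (\<phi> (p h) ?e) = 0 \<or> snd (\<phi> (p h) ?e) = 0"
    by (rule component_zero[OF h W' lin bij])
  then show "pmod_zero n W \<or> pmod_zero n W'"
  proof
    assume "fst (\<phi> (p h) ?e) = 0"
    then have "snd (?\<psi> (p h) ?e) = 0" by simp
    with W' W lin' bij' nat' have "pmod_zero n W" by (rule summand_zero)
    then show ?thesis ..
  next
    assume "snd (\<phi> (p h) ?e) = 0"
    with W W' lin bij nat have "pmod_zero n W'" by (rule summand_zero)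
    then show ?thesis ..
  qed
qed

end

section \<open>The construction\<close>

lemma initial_segment:
  fixes S :: "nat set"
  assumes "finite S" "\<And>k l. k \<in> S \<Longrightarrow> l < k \<Longrightarrow> l \<in> S"
  shows "S = {..<card S}"
proof -
  obtain k where "k \<notin> S" using assms(1) ex_new_if_finite infinite_UNIV_nat by blast
  define c where "c = (LEAST k. k \<notin> S)"
  have "c \<notin> S" unfolding c_def by (rule LeastI) fact
  moreover have "k \<in> S" if "k < c" for k using that not_less_Least unfolding c_def by blast
  moreover have "k < c" if "k \<in> S" for k
    using that assms(2)[of k c] \<open>c \<notin> S\<close> by (cases k c rule: linorder_cases) auto
  ultimately have "S = {..<c}" by auto
  then show ?thesis by simp
qed

text \<open>The holes are numbered by \<open>j < m\<close>; the hole \<open>j\<close> is a single point in the directions \<open>0\<close> and all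
  \<open>k \<ge> 1\<close> with \<open>j < J k\<close>. As \<open>J\<close> is antitone, \<open>J i - J (i + 1)\<close> holes are points in \<open>i + 1\<close> directions.\<close>

locale configuration =
  fixes n m :: nat and J :: "nat \<Rightarrow> nat"
  assumes n: "2 \<le> n" and J_antimono: "i \<le> k \<Longrightarrow> J k \<le> J i" and J_1: "J 1 = m" and J_n: "J n = 0"
begin

lemma J_le: "1 \<le> k \<Longrightarrow> J k \<le> m"
  using J_antimono[of 1 k] J_1 by simp

definition frame :: "point set" where
  "frame = {x \<in> grid n. \<forall>k. 2 \<le> k \<and> k < n \<longrightarrow> -1 \<le> x k \<and> x k \<le> 1}"

text \<open>The interval \<open>1\<close>, on one side of all holes in the direction \<open>1\<close>, is the common one to which all
  others are glued. The interval \<open>0\<close> contains the points that lie on the negative side of the holes in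
  some direction \<open>k \<ge> 1\<close>, the interval \<open>k\<close> with \<open>2 \<le> k < n\<close> those on the positive side of the first \<open>J k\<close> holes in
  the direction \<open>k\<close>, and \<open>n - 1 + j\<close> those between the holes \<open>j - 1\<close> and \<open>j\<close>.\<close>

definition piece :: "nat \<Rightarrow> point set" where
  "piece i = {x \<in> frame.
     if i = 0 then 0 \<le> x 0 \<and> x 0 \<le> 2 * int m \<and> -1 \<le> x 1 \<and> x 0 + x 1 \<le> 2 * int m + 1 \<and>
       (x 0 = 0 \<or> x 1 = -1 \<or> (\<exists>k. 2 \<le> k \<and> k < n \<and> x k = -1 \<and> x 0 \<le> 2 * int (J k)))
     else if i = 1 then -1 \<le> x 0 \<and> 1 \<le> x 1 \<and> x 0 + x 1 \<le> 2 * int m + 1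
     else if i < n then 0 \<le> x 0 \<and> x 0 \<le> 2 * int (J i) \<and> -2 \<le> x 1 \<and>
         x 1 \<le> 2 * int m + 1 - 2 * int (J i) \<and> x i = 1
     else x 0 = 2 * int (Suc i - n) \<and> -1 - x 0 \<le> x 1 \<and> x 0 + x 1 \<le> 2 * int m + 1}"

text \<open>Chosen pairwise incomparable: the hub starts at \<open>-1\<close> in direction
  \<open>0\<close>, interval \<open>0\<close> and the intervals between holes lie on
  \<open>x 0 + x 1 = -1\<close>, and the side intervals drop to \<open>-2\<close> in direction
  \<open>1\<close> because they are higher than interval \<open>0\<close> in their own
  direction.\<close>

definition least :: "nat \<Rightarrow> point" where
  "least i = (\<lambda>k.
     if k = 0 then (if i = 1 then -1 else if i < n then 0 else 2 * int (Suc i - n))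
     else if k = 1 then (if i = 0 then -1 else if i =
         1 then 1 else if i < n then -2 else -1 - 2 * int (Suc i - n))
     else if k < n then (if k = i then 1 else -1) else 0)"

text \<open>The points on \<open>x 0 + x 1 = 2 * m + 1\<close> with an even first coordinate and the
  top value 1 in all further directions.\<close>

definition glue :: "nat \<Rightarrow> point" where
  "glue j = (\<lambda>k. if k = 0 then 2 * int j else if k =
      1 then 2 * int m + 1 - 2 * int j else if k < n then 1 else 0)"

definition total :: "point set" where
  "total = (\<Union>i<n + m. piece i)"

text \<open>The four alternatives describe the part above the holes, the box with the holes filled in, and the
  two kinds of tentacles.\<close>

definition filled :: "point set" where
  "filled = {x \<in> frame.
     -1 \<le> x 0 \<and> 1 \<le> x 1 \<and> x 0 + x 1 \<le> 2 * int m + 1 \<or>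
     0 \<le> x 0 \<and> x 0 \<le> 2 * int m \<and> -1 \<le> x 1 \<and> x 1 \<le> 1 \<or>
     x 1 = -2 \<and> 0 \<le> x 0 \<and> (\<exists>k. 2 \<le> k \<and> k < n \<and> x 0 \<le> 2 * int (J k) \<and> x k = 1) \<or>
     (\<exists>j. 1 \<le> j \<and> j \<le> m \<and> x 0 = 2 * int j) \<and> -1 - x 0 \<le> x 1 \<and> x 1 \<le> -2}"

definition hole :: "nat \<Rightarrow> point set" where
  "hole j = {x \<in> frame. x 0 = 2 * int j + 1 \<and> x 1 = 0 \<and> (\<forall>k. 2 \<le> k \<and> k < n \<and> j < J k \<longrightarrow> x k = 0)}"

section \<open>The intervals and their least elements\<close>

lemma least_frame: "i < n + m \<Longrightarrow> least i \<in> frame"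
  using n by (auto simp: least_def frame_def grid_def)

lemma least_in_piece: "i < n + m \<Longrightarrow> least i \<in> piece i"
  using least_frame[of i] n J_le[of i] by (auto simp: piece_def) (auto simp: least_def)

lemma least_le:
  assumes "x \<in> piece i"
  shows "least i \<le> x"
proof (rule le_funI)
  fix k
  consider "k = 0" | "k = 1" | "2 \<le> k" "k < n" | "n \<le> k" by linarith
  then show "least i k \<le> x k"
    using assms n by cases (auto simp: piece_def least_def frame_def grid_def split: if_splits)
qed

text \<open>Only interval \<open>0\<close> is not a box cut off by the antidiagonal. Its
  alternatives are inherited by smaller points, since a coordinate that already has its value in
  \<open>least 0\<close> cannot decrease further.\<close>

lemma piece_convex:
  assumes x: "x \<in> piece i" and y: "y \<in> grid n" "least i \<le> y" "y \<le> x"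
  shows "y \<in> piece i"
proof -
  have le: "least i k \<le> y k" "y k \<le> x k" for k using y by (auto simp: le_fun_def)
  have f: "y \<in> frame"
  proof -
    have "-1 \<le> least i k" if "2 \<le> k" "k < n" for k using that by (simp add: least_def)
    moreover have "x k \<le> 1" if "2 \<le> k" "k < n" for k using that x by (simp add: piece_def frame_def)
    ultimately show ?thesis using y(1) le by (fastforce simp: frame_def intro: order_trans)
  qed
  consider "i = 0" | "i = 1" | "2 \<le> i" "i < n" | "n \<le> i" by linarith
  then show ?thesis
  proof cases
    case 1
    have "y k = -1" if "2 \<le> k" "k < n" "x k = -1" for k
      using le[of k] that 1 by (simp add: least_def)
    with 1 x f le[of 0] le[of 1] n show ?thesis
      by (auto simp: piece_def least_def)
  next
    case 2
    with x f le[of 0] le[of 1] show ?thesis by (auto simp: piece_def least_def)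
  next
    case 3
    with x f le[of 0] le[of 1] le[of i] show ?thesis by (auto simp: piece_def least_def)
  next
    case 4
    with n x f le[of 0] le[of 1] show ?thesis by (auto simp: piece_def least_def)
  qed
qed

lemma least_separate:
  assumes "i < n + m" "j < n + m" "i \<noteq> j"
  shows "least i \<notin> piece j"
proof -
  consider "i = 0" | "i = 1" | "2 \<le> i" "i < n" | "n \<le> i" by linarith
  then show ?thesis
    using assms n by cases (auto simp: piece_def least_def)
qed

section \<open>The filled set, the gluing points and the covering\<close>

lemma J_bound: "t \<le> 2 * int (J k) \<Longrightarrow> 2 \<le> k \<Longrightarrow> t \<le> 2 * int m"
  using J_le[of k] by auto

lemma filled_bounds:
  assumes "x \<in> filled"
  shows "-1 \<le> x 0" "x 0 \<le> 2 * int m" "x 0 + x 1 \<le> 2 * int m + 1"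
  using assms by (auto simp: filled_def dest: J_bound)

lemma filled_cases [consumes 1, case_names a b c d]:
  assumes "x \<in> filled"
  obtains "-1 \<le> x 0" "1 \<le> x 1" "x 0 + x 1 \<le> 2 * int m + 1"
    | "0 \<le> x 0" "x 0 \<le> 2 * int m" "-1 \<le> x 1" "x 1 \<le> 1"
    | k where "x 1 = -2" "0 \<le> x 0" "2 \<le> k" "k < n" "x 0 \<le> 2 * int (J k)" "x k = 1"
    | j where "1 \<le> j" "j \<le> m" "x 0 = 2 * int j" "-1 - x 0 \<le> x 1" "x 1 \<le> -2"
  using assms unfolding filled_def by blast

text \<open>The bound on \<open>x 0 + x 1\<close> is attained at \<open>glue j\<close> and the other
  coordinates are at their top value. Proving maximality in all of \<open>filled\<close> settles it
  in every interval.\<close>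

lemma filled_maximal:
  assumes "x \<in> filled" "glue j \<le> x" "j \<le> m"
  shows "x = glue j"
proof
  fix k
  have le: "glue j k \<le> x k" for k using assms(2) by (auto simp: le_fun_def)
  have "x 0 + x 1 \<le> 2 * int m + 1" using assms(1) by (rule filled_bounds)
  then have "x 0 = glue j 0" "x 1 = glue j 1" using le[of 0] le[of 1] by (auto simp: glue_def)
  moreover have "x k = glue j k" if "2 \<le> k" "k < n"
    using le[of k] assms(1) that by (force simp: filled_def frame_def glue_def)
  moreover have "x k = glue j k" if "n \<le> k"
    using assms(1) that n by (auto simp: filled_def frame_def glue_def grid_def)
  ultimately show "x k = glue j k" by (metis One_nat_def Suc_leI less_one linorder_neqE_nat not_le
      numeral_2_eq_2)
qed

lemma glue_frame: "glue j \<in> frame"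
  using n by (auto simp: glue_def frame_def grid_def)

lemma glue_hub: "j \<le> m \<Longrightarrow> glue j \<in> piece 1"
  using glue_frame[of j] by (auto simp: piece_def glue_def)

text \<open>Interval \<open>0\<close> runs up the line \<open>x 0 = 0\<close> to
  \<open>glue 0\<close>, the greatest element of a side interval \<open>i\<close> is
  \<open>glue (J i)\<close>, and the interval \<open>n - 1 + j\<close> ends in
  \<open>glue j\<close>.\<close>

lemma glue_piece:
  assumes "i < n + m"
  shows "\<exists>j\<le>m. glue j \<in> piece i"
proof -
  consider "i = 0" | "i = 1" | "2 \<le> i" "i < n" | "n \<le> i" by linarith
  then show ?thesis
  proof cases
    case 1
    then show ?thesis using glue_frame[of 0] by (intro exI[of _ 0]) (auto simp: piece_def glue_def)
  next
    case 2
    then show ?thesis using glue_hub by auto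
  next
    case 3
    then show ?thesis
      using glue_frame[of "J i"] J_le[of i] by (intro exI[of _ "J i"]) (auto simp: piece_def
          glue_def)
  next
    case 4
    then show ?thesis
      using glue_frame[of "Suc i - n"] n assms
          by (intro exI[of _ "Suc i - n"]) (auto simp: piece_def glue_def)
  qed
qed

lemma piece_filled:
  assumes "i < n + m" "x \<in> piece i"
  shows "x \<in> filled"
proof -
  consider "i = 0" | "i = 1" | "2 \<le> i" "i < n" | "n \<le> i" by linarith
  then show ?thesis
  proof cases
    case 3
    then show ?thesis using assms J_le[of i] by (auto simp: piece_def filled_def)
  next
    case 4
    have "1 \<le> Suc i - n" "Suc i - n \<le> m" using 4 assms(1) by auto
    moreover have "x \<in> frame" "x 0 = 2 * int (Suc i - n)" "-1 - x 0 \<le> x 1" "x 0 + x 1 \<le> 2 * int m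
        + 1"
      using assms(2) 4 n by (auto simp: piece_def)
    ultimately show ?thesis unfolding filled_def by auto
  qed (use assms in \<open>auto simp: piece_def filled_def\<close>)
qed

lemma piece_hole:
  assumes "i < n + m" "x \<in> piece i"
  shows "x \<notin> hole j"
proof
  assume h: "x \<in> hole j"
  consider "i = 0" | "i = 1" | "2 \<le> i" "i < n" | "n \<le> i" by linarith
  then show False
  proof cases
    case 1
    \<comment> \<open>In a hole \<open>x 0\<close> is odd and \<open>x 1 = 0\<close>, which leaves
      the third alternative. There \<open>2 * j + 1\<close> is at most \<open>2 * J k\<close>, so
      \<open>j < J k\<close> and the hole requires \<open>x k = 0\<close>.\<close>
    with assms h obtain k where "2 \<le> k" "k < n" "x k = -1" "x 0 \<le> 2 * int (J k)"
      by (auto simp: piece_def hole_def)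
    with h show False by (auto simp: hole_def)
  next
    case 2
    with assms h show False by (auto simp: piece_def hole_def)
  next
    case 3
    with assms h show False by (auto simp: piece_def hole_def)
  next
    case 4
    \<comment> \<open>Parity: intervals between holes have even first coordinate, holes have odd
      ones.\<close>
    with assms h n have "2 * int (Suc i - n) = 2 * int j + 1" by (auto simp: piece_def hole_def)
    then show False by presburger
  qed
qed

lemma total_eq: "total = filled - (\<Union>j<m. hole j)"
proof (intro antisym subsetI)
  fix x assume "x \<in> total"
  then show "x \<in> filled - (\<Union>j<m. hole j)"
    using piece_filled piece_hole unfolding total_def by blast
next
  fix x assume x: "x \<in> filled - (\<Union>j<m. hole j)"
  then have f: "x \<in> frame" by (auto simp: filled_def)
  have col: "x \<in> total" if "1 \<le> j" "j \<le> m" "x 0 =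
      2 * int j" "-1 - x 0 \<le> x 1" "x 0 + x 1 \<le> 2 * int m + 1" for j
  proof -
    have "x \<in> piece (n + j - 1)" using that f n by (auto simp: piece_def)
    moreover have "n + j - 1 < n + m" using that n by auto
    ultimately show ?thesis by (auto simp: total_def)
  qed
  have hub: "x \<in> total" if "-1 \<le> x 0" "1 \<le> x 1" "x 0 + x 1 \<le> 2 * int m + 1"
  proof -
    have "x \<in> piece 1" using that f by (simp add: piece_def)
    then show ?thesis using n by (auto simp: total_def)
  qed
  have low: "x \<in> total" if "0 \<le> x 0" "x 0 \<le> 2 * int m" "-1 \<le> x 1" "x 1 \<le> 1"
       "x 0 = 0 \<or> x 1 = -1 \<or> (\<exists>k. 2 \<le> k \<and> k < n \<and> x k = -1 \<and> x 0 \<le> 2 * int (J k))"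
  proof -
    have "x \<in> piece 0" using that f by (simp add: piece_def)
    then show ?thesis using n by (auto simp: total_def)
  qed
  have side: "x \<in> total" if "0 \<le> x 0" "x 0 \<le> 2 * int (J k)" "-2 \<le> x 1" "x 1 \<le> 1" "x k =
      1" "2 \<le> k" "k < n" for k
  proof -
    have "x \<in> piece k" using that f J_le[of k] by (auto simp: piece_def)
    then show ?thesis using that by (auto simp: total_def)
  qed
  from x have "x \<in> filled" by simp
  then show "x \<in> total"
  proof (cases rule: filled_cases)
    case a
    then show ?thesis by (rule hub)
  next
    case b
    then consider "x 1 = 1" | "x 1 = -1" | "x 1 = 0" by linarith
    then show ?thesis
    proof cases
      case 1
      with b show ?thesis by (intro hub) auto
    next
      case 2
      with b show ?thesis by (intro low) auto
    next
      case 3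
      obtain j where j: "x 0 = 2 * int j \<or> x 0 = 2 * int j + 1"
        using b(1) by (metis nonneg_int_cases oddE evenE of_nat_Suc of_nat_mult of_nat_numeral
            Suc_eq_plus1 of_nat_add of_nat_1)
      then show ?thesis
      proof
        assume j: "x 0 = 2 * int j"
        show ?thesis
        proof (cases "j = 0")
          case True
          with b j show ?thesis by (intro low) auto
        next
          case False
          with b j 3 show ?thesis by (intro col[of j]) auto
        qed
      next
        assume j: "x 0 = 2 * int j + 1"
        with b have "j < m" by auto
        with x have "x \<notin> hole j" by blast
        \<comment> \<open>A point level with hole \<open>j\<close> but outside it is off centre in
          some direction \<open>k\<close> with \<open>j < J k\<close>. Interval \<open>0\<close>
          takes it on the negative side and interval \<open>k\<close> on the positive side;
          \<open>j < J k\<close> gives the bound \<open>2 * J k\<close> required by both.\<close>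
        with f j 3 obtain k where k: "2 \<le> k" "k < n" "j < J k" "x k \<noteq> 0" by (auto simp: hole_def)
        then have "-1 \<le> x k" "x k \<le> 1" using f by (auto simp: frame_def)
        with k(4) have "x k = -1 \<or> x k = 1" by linarith
        then show ?thesis
        proof
          assume "x k = -1"
          with b j k show ?thesis by (intro low) auto
        next
          assume "x k = 1"
          with b j k show ?thesis by (intro side[of k]) auto
        qed
      qed
    qed
  next
    case (c k)
    then show ?thesis by (intro side[of k]) auto
  next
    case (d j)
    then show ?thesis by (intro col[of j]) auto
  qed
qed

lemma finite_total: "finite total"
proof (rule finite_subset[OF _ finite_grid_box])
  show "total \<subseteq> {x \<in> grid n. \<forall>k<n. -1 - 2 * int m - 2 \<le> x k \<and> x k \<le> 2 * int m + 2}"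
  proof
    fix x assume "x \<in> total"
    then have x: "x \<in> filled" by (simp add: total_eq)
    then have f: "x \<in> frame" by (simp add: filled_def)
    have "-1 - 2 * int m - 2 \<le> x k \<and> x k \<le> 2 * int m + 2" if "k < n" for k
    proof -
      consider "k = 0" | "k = 1" | "2 \<le> k" by linarith
      then show ?thesis
      proof cases
        case 1
        then show ?thesis using filled_bounds[OF x] by auto
      next
        case 2
        then show ?thesis using x filled_bounds[OF x] by (auto simp: filled_def)
      next
        case 3
        then have "-1 \<le> x k \<and> x k \<le> 1" using f that by (auto simp: frame_def)
        then show ?thesis by linarith
      qed
    qed
    then show "x \<in> {x \<in> grid n. \<forall>k<n. -1 - 2 * int m - 2 \<le> x k \<and> x k \<le> 2 * int m + 2}"
      using f by (auto simp: frame_def)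
  qed
qed

sublocale glued n "{..<n + m}" 1 piece least "glue ` {..m}"
proof unfold_locales
  show "finite {..<n + m}" by simp
  show "1 \<in> {..<n + m}" using n by simp
  show "piece i \<subseteq> grid n" for i by (auto simp: piece_def frame_def)
  show "glue ` {..m} \<subseteq> piece 1" using glue_hub by auto
next
  fix i assume i: "i \<in> {..<n + m}"
  then show "least i \<in> piece i" by (simp add: least_in_piece)
  show "least i \<notin> glue ` {..m}"
  proof
    assume "least i \<in> glue ` {..m}"
    then obtain j where j: "j \<le> m" "least i = glue j" by auto
    then have "least i \<in> piece 1" using glue_hub by simp
    then have "i = 1" using least_separate[of i 1] i n by auto
    then show False using fun_cong[OF j(2), of 0] by (simp add: least_def glue_def)
  qed
  show "glue ` {..m} \<inter> piece i \<noteq> {}" using glue_piece[of i] i by auto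
next
  show "least i \<le> x" if "x \<in> piece i" for i x using that by (rule least_le)
  show "y \<in> piece i" if "x \<in> piece i" "y \<in> grid n" "least i \<le> y" "y \<le> x" for i x y
    using that by (rule piece_convex)
  show "least i \<notin> piece j" if "i \<in> {..<n + m}" "j \<in> {..<n + m}" "i \<noteq> j" for i j
    using that by (intro least_separate) auto
  show "y = g" if "g \<in> glue ` {..m}" "i \<in> {..<n + m}" "y \<in> piece i" "g \<le> y" for g i y
    using that filled_maximal piece_filled by auto
qed

lemma support_total: "pmod_support n (glue_module :: (nat \<Rightarrow>\<^sub>0 'k::field) pmod) = total"
  unfolding total_def by (rule support_glue_module)

text \<open>Segments in direction \<open>1\<close> to the height \<open>x 1 = 1\<close> stay inside,
  so both kinds of tentacles and the part above the holes retract to that height, where a box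
  remains. A lower height would fail, since at \<open>x 0 = -1\<close> the set begins only at
  \<open>x 1 = 1\<close>.\<close>

lemma pos_acyclic_filled: "pos_acyclic TYPE('k::field) n filled"
proof (rule pos_acyclic_retract[where k = 1 and c = 1 and R = "2 * m + 3"])
  show "1 < n" using n by simp
  show "x(1 := s) \<in> filled" if x: "x \<in> filled" and s: "x 1 \<le> s \<and> s \<le> 1 \<or> 1 \<le> s \<and> s \<le> x 1" for x s
  proof -
    have "x \<in> frame" using x by (simp add: filled_def)
    then have f: "x(1 := s) \<in> frame" using n by (auto simp: frame_def grid_def)
    have up: "x(1 := s) \<in> filled" if "-1 \<le> x 0" "1 \<le> s" "x 0 + s \<le> 2 * int m + 1"
      using that f by (simp add: filled_def)
    have mid: "x(1 := s) \<in> filled" if "0 \<le> x 0" "x 0 \<le> 2 * int m" "-1 \<le> s" "s \<le> 1"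
      using that f by (simp add: filled_def)
    from x show ?thesis
    proof (cases rule: filled_cases)
      case a
      with s show ?thesis by (intro up) auto
    next
      case b
      with s show ?thesis by (intro mid) auto
    next
      case (c k)
      show ?thesis
      proof (cases "s = -2")
        case True
        with c(1) have "x(1 := s) = x" by (simp add: fun_upd_idem)
        with x show ?thesis by simp
      next
        case False
        with c s J_bound[OF c(5,3)] show ?thesis by (intro mid) auto
      qed
    next
      case (d j)
      show ?thesis
      proof (cases "s \<le> -2")
        case True
        have "-1 - x 0 \<le> s" using d(4,5) s by auto
        moreover have "\<exists>j. 1 \<le> j \<and> j \<le> m \<and> x 0 = 2 * int j" using d by blast
        ultimately show ?thesis using True f by (simp add: filled_def)
      next
        case False
        with d s show ?thesis by (intro mid) auto
      qed
    qed
  qed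
  show "\<bar>x 1 - 1\<bar> \<le> int (2 * m + 3)" if x: "x \<in> filled" for x
    using filled_bounds[OF x] x by (auto simp: filled_def)
  show "pos_acyclic TYPE('k) n (filled \<inter> {x. x 1 = 1})"
  proof (rule pos_acyclic_star_shaped[where c = "\<lambda>k. of_bool (k = 1)" and R = "2 * m + 1"])
    let ?Y = "{x \<in> frame. -1 \<le> x 0 \<and> x 0 \<le> 2 * int m \<and> x 1 = 1}"
    have eq: "filled \<inter> {x. x 1 = 1} = ?Y"
    proof (intro antisym subsetI)
      fix x assume x: "x \<in> filled \<inter> {x. x 1 = 1}"
      then have f: "x \<in> filled" by simp
      have "x \<in> frame" using f by (simp add: filled_def)
      then show "x \<in> ?Y" using x filled_bounds(1,2)[OF f] by simp
    next
      fix x assume "x \<in> ?Y"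
      then show "x \<in> filled \<inter> {x. x 1 = 1}" by (simp add: filled_def)
    qed
    show "filled \<inter> {x. x 1 = 1} \<subseteq> grid n" by (auto simp: filled_def frame_def)
    show "x(k := s) \<in> filled \<inter> {x. x 1 = 1}"
      if x: "x \<in> filled \<inter> {x. x 1 = 1}" and k: "k < n"
        and s: "x k \<le> s \<and> s \<le> of_bool (k = 1) \<or> of_bool (k = 1) \<le> s \<and> s \<le> x k" for x k s
    proof -
      have xY: "x \<in> ?Y" using x unfolding eq .
      consider "k = 0" | "k = 1" | "2 \<le> k" by linarith
      then have "x(k := s) \<in> ?Y"
      proof cases
        case 1
        then show ?thesis using xY s n by (auto simp: frame_def grid_def)
      next
        case 2
        then show ?thesis using xY s n by (auto simp: fun_upd_idem)
      next
        case 3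
        then have "-1 \<le> x k" "x k \<le> 1" using xY k by (auto simp: frame_def)
        then show ?thesis using 3 xY s k by (auto simp: frame_def grid_def)
      qed
      then show ?thesis unfolding eq .
    qed
    show "\<bar>x k - of_bool (k = 1)\<bar> \<le> int (2 * m + 1)" if x: "x \<in> filled \<inter> {x. x 1 =
        1}" and k: "k < n" for x k
    proof -
      have xY: "x \<in> ?Y" using x unfolding eq .
      consider "k = 0" | "k = 1" | "2 \<le> k" by linarith
      then show ?thesis
      proof cases
        case 3
        then have "-1 \<le> x k" "x k \<le> 1" using xY k by (auto simp: frame_def)
        then show ?thesis using 3 by auto
      qed (use xY in auto)
    qed
  qed
qed

section \<open>The holes and the Betti numbers of the support\<close>

definition star :: "nat \<Rightarrow> nat set" where
  "star j = {k. k < n \<and> (k = 0 \<or> j < J k)}"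

definition corner :: "nat \<Rightarrow> point" where
  "corner j = (\<lambda>k. if k = 0 then 2 * int j + 1 else if k < n \<and> k \<notin> star j then -1 else 0)"

definition touching :: "nat \<Rightarrow> cube set" where
  "touching j = {(a, K). a \<in> grid n \<and> K \<subseteq> {..<n} \<and> vertices (a, K) \<subseteq> filled \<and>
      vertices (a, K) \<inter> hole j \<noteq> {}}"

lemma star_mem: "0 \<in> star j" "j < m \<Longrightarrow> 1 \<in> star j"
  using n J_1 by (auto simp: star_def)

lemma star_ge_2: "2 \<le> k \<Longrightarrow> k < n \<Longrightarrow> k \<in> star j \<longleftrightarrow> j < J k"
  by (auto simp: star_def)

text \<open>All points of the frame with first coordinate from \<open>2 * j\<close> to
  \<open>2 * j + 2\<close> and second one from \<open>-1\<close> to \<open>1\<close> belong to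
  \<open>filled\<close>. Near the hole, membership in \<open>filled\<close> is thus automatic, and
  meeting the hole is a condition on each coordinate.\<close>

lemma touching_iff:
  assumes j: "j < m"
  shows "(a, K) \<in> touching j \<longleftrightarrow> a \<in> grid n \<and> K \<subseteq> {..<n} \<and>
      (\<forall>k<n. if k \<in> star j then (if k \<in> K then a k = corner j k - 1 \<or> a k = corner j k else a k =
          corner j k)
              else -1 \<le> a k \<and> a k + of_bool (k \<in> K) \<le> 1)" (is "_ \<longleftrightarrow> ?R")
proof
  assume t: "(a, K) \<in> touching j"
  then obtain x where x: "x \<in> vertices (a, K)" "x \<in> hole j" by (auto simp: touching_def)
  have "if k \<in> star j then (if k \<in> K then a k = corner j k - 1 \<or> a k = corner j k else a k =
      corner j k)
              else -1 \<le> a k \<and> a k + of_bool (k \<in> K) \<le> 1" if k: "k < n" for k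
  proof (cases "k \<in> star j")
    case True
    have "x k = corner j k"
    proof -
      consider "k = 0" | "k = 1" | "2 \<le> k" by linarith
      then show ?thesis using x(2) k True star_ge_2[of k j]
          by cases (auto simp: hole_def corner_def)
    qed
    with x(1)[unfolded in_vertices_iff, rule_format, of k] True show ?thesis
        by (auto split: if_splits)
  next
    case False
    then have k2: "2 \<le> k" using star_mem[of j] j
        by (metis One_nat_def Suc_leI less_one linorder_neqE_nat not_le numeral_2_eq_2)
    have "vertices (a, K) \<subseteq> frame" using t by (auto simp: touching_def filled_def)
    then have "a \<in> frame" "k \<in> K \<Longrightarrow> a(k := a k + 1) \<in> frame"
      using base_in_vertices upd_in_vertices by blast+
    then have "-1 \<le> a k" "a k \<le> 1" "k \<in> K \<Longrightarrow> (a(k := a k + 1)) k \<le> 1" using k k2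
        unfolding frame_def by blast+
    then show ?thesis using False by auto
  qed
  with t show ?R by (auto simp: touching_def)
next
  assume r: ?R
  then have r': "if k \<in> star j then (if k \<in> K then a k = corner j k - 1 \<or> a k =
      corner j k else a k = corner j k)
              else -1 \<le> a k \<and> a k + of_bool (k \<in> K) \<le> 1" if "k < n" for k using that by blast
  have K: "K \<subseteq> {..<n}" and a: "a \<in> grid n" using r by auto
  have corner01: "corner j 0 = 2 * int j + 1" "corner j 1 = 0"
    using star_mem[of j] j by (auto simp: corner_def)
  have "x \<in> filled" if x: "x \<in> vertices (a, K)" for x
  proof -
    have xk: "if k \<in> K then x k \<in> {a k, a k + 1} else x k = a k" for k using x
        unfolding in_vertices_iff by blast
    have "x 0 = 2 * int j \<or> x 0 = 2 * int j + 1 \<or> x 0 = 2 * int j + 2"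
      using xk[of 0] r'[of 0] n star_mem(1)[of j] corner01(1) by (auto split: if_splits)
    moreover have "-1 \<le> x 1 \<and> x 1 \<le> 1"
      using xk[of 1] r'[of 1] n star_mem(2)[OF j] corner01(2) by (auto split: if_splits)
    moreover have "-1 \<le> x k \<and> x k \<le> 1" if "2 \<le> k" "k < n" for k
    proof (cases "k \<in> star j")
      case True
      then have "corner j k = 0" using that by (simp add: corner_def)
      with xk[of k] r'[OF that(2)] True show ?thesis by (auto split: if_splits)
    next
      case False
      with xk[of k] r'[OF that(2)] show ?thesis by (auto split: if_splits)
    qed
    moreover have "x k = 0" if "n \<le> k" for k
      using xk[of k] K a that by (auto simp: grid_def split: if_splits)
    ultimately show ?thesis using j by (auto simp: filled_def frame_def grid_def)
  qed
  \<comment> \<open>The vertex that takes the prescribed value of the hole in the directions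
    \<open>star j\<close> and that of the least vertex elsewhere.\<close>
  moreover have "(\<lambda>k. if k \<in> star j then corner j k else a k) \<in> vertices (a, K) \<inter> hole j" (is "?x
      \<in> _")
  proof
    have "if k \<in> K then ?x k \<in> {a k, a k + 1} else ?x k = a k" for k
    proof (cases "k \<in> star j")
      case True
      then have "k < n" by (simp add: star_def)
      with r'[OF this] True show ?thesis by auto
    qed auto
    then show "?x \<in> vertices (a, K)" unfolding in_vertices_iff by blast
    have "-1 \<le> ?x k \<and> ?x k \<le> 1" if "2 \<le> k" "k < n" for k
      using r'[OF that(2)] that by (cases "k \<in> star j") (auto simp: corner_def of_bool_def split:
          if_splits)
    moreover have "?x k = 0" if "n \<le> k" for k using a that by (auto simp: grid_def star_def)
    ultimately have "?x \<in> frame" by (simp add: frame_def grid_def)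
    moreover have "?x k = 0" if "2 \<le> k" "k < n" "j < J k" for k
      using that star_ge_2[of k j] by (simp add: corner_def)
    moreover have "?x 0 = 2 * int j + 1" "?x 1 = 0" using star_mem[of j] j corner01 by auto
    ultimately show "?x \<in> hole j" unfolding hole_def mem_Collect_eq by blast
  qed
  ultimately show "(a, K) \<in> touching j" using K a by (auto simp: touching_def)
qed

sublocale punctured n total filled "{..<m}" star corner touching
proof unfold_locales
  show "finite {..<m}" by simp
  show "star j \<subseteq> {..<n}" for j by (auto simp: star_def)
  show "corner j \<in> grid n" for j using n by (auto simp: corner_def grid_def)
  show "corner j k = -1" if "j \<in> {..<m}" "k < n" "k \<notin> star j" for j k
    using that star_mem(1)[of j] by (cases "k = 0") (auto simp: corner_def)
  show "touching j \<inter> touching j' = {}" if jj: "j \<in> {..<m}" "j' \<in> {..<m}" "j \<noteq> j'" for j j'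
  proof -
    \<comment> \<open>The spacing 2 pays off: the first coordinate of a touching cube determines
      \<open>j\<close>.\<close>
    have zero: "a 0 = 2 * int j \<or> a 0 = 2 * int j + 1" if "j \<in> {..<m}" "(a, K) \<in> touching j"
        for a K j
    proof -
      have "\<forall>k<n. if k \<in> star j then (if k \<in> K then a k = corner j k - 1 \<or> a k =
          corner j k else a k = corner j k)
              else -1 \<le> a k \<and> a k + of_bool (k \<in> K) \<le> 1"
        using that touching_iff[of j a K] by simp
      from this[rule_format, of 0] n star_mem(1)[of j] show ?thesis
        by (auto simp: corner_def split: if_splits)
    qed
    have False if "(a, K) \<in> touching j" "(a, K) \<in> touching j'" for a K
      using zero[OF jj(1) that(1)] zero[OF jj(2) that(2)] jj(3) by presburger
    then show ?thesis by auto
  qed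
  show "((a, K) \<in> touching j) = (a \<in> grid n \<and> K \<subseteq> {..<n} \<and>
      (\<forall>k<n. if k \<in> star j then (if k \<in> K then a k = corner j k - 1 \<or> a k = corner j k else a k =
          corner j k)
              else -1 \<le> a k \<and> a k + of_bool (k \<in> K) \<le> 1))" if "j \<in> {..<m}" for j a K
    using that by (intro touching_iff) simp
  show "(a, K) \<in> cubes n filled (card K)" if "(a, K) \<in> touching j" for j a K
    using that by (auto simp: touching_def cubes_def)
  show "(a, insert l K) \<in> touching j"
    if "(a, K) \<in> touching j" "l \<notin> K" "(a, insert l K) \<in> cubes n filled i" for j a K l i
    using that vertices_coface(1)[OF that(2), of a] unfolding touching_def cubes_def by blast
  show "(a(l := a l - 1), insert l K) \<in> touching j"
    if "(a, K) \<in> touching j" "l \<notin> K" "(a(l := a l - 1), insert l K) \<in> cubes n filled i"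
        for j a K l i
    using that vertices_coface(2)[OF that(2), of a] unfolding touching_def cubes_def by blast
  show "cubes n total i = cubes n filled i - (\<Union>j\<in>{..<m}. touching j)" for i
  proof -
    have "vertices q \<subseteq> total \<longleftrightarrow> vertices q \<subseteq> filled \<and> (\<forall>j<m. vertices q \<inter> hole j = {})" for q
      unfolding total_eq by blast
    then show ?thesis by (auto simp: cubes_def touching_def)
  qed
qed

text \<open>As \<open>J\<close> is antitone, \<open>star j\<close> is an initial segment, and its
  size is detected by the first direction that is missing.\<close>

lemma card_star:
  assumes "1 \<le> i" "i < n"
  shows "card (star j) = Suc i \<longleftrightarrow> J (Suc i) \<le> j \<and> j < J i"
proof -
  have "star j = {..<card (star j)}"
  proof (rule initial_segment)
    show "finite (star j)" by (simp add: star_def)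
    show "l \<in> star j" if "k \<in> star j" "l < k" for k l
      using that J_antimono[of l k] by (auto simp: star_def)
  qed
  then have mem: "k \<in> star j \<longleftrightarrow> k < card (star j)" for k by blast
  have "card (star j) = Suc i \<longleftrightarrow> i \<in> star j \<and> Suc i \<notin> star j"
    unfolding mem by auto
  also have "i \<in> star j \<longleftrightarrow> j < J i" using assms by (auto simp: star_def)
  \<comment> \<open>For \<open>Suc i = n\<close> the direction does not exist;
    \<open>J n = 0\<close> makes the formula right in this case as well.\<close>
  also have "Suc i \<notin> star j \<longleftrightarrow> J (Suc i) \<le> j"
    using assms J_n by (cases "Suc i = n") (auto simp: star_def)
  finally show ?thesis by auto
qed

lemma betti_total:
  assumes "0 < i" "i < n"
  shows "betti TYPE('k::field) n total i = J i - J (Suc i)"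
proof -
  have "betti TYPE('k) n total i = card {j \<in> {..<m}. card (star j) = Suc i}"
    by (rule betti_punctured[OF pos_acyclic_filled assms(1)])
  also have "{j \<in> {..<m}. card (star j) = Suc i} = {J (Suc i)..<J i}"
  proof -
    have card: "card (star j) = Suc i \<longleftrightarrow> J (Suc i) \<le> j \<and> j < J i" for j
      using assms by (intro card_star) auto
    have "J i \<le> m" using assms by (intro J_le) auto
    then show ?thesis unfolding card by auto
  qed
  finally show ?thesis by simp
qed

end

text \<open>Settles \<open>n = 1\<close>, where no Betti number is prescribed and the direction
  \<open>1\<close> of the construction is missing.\<close>

lemma exists_point_module:
  "\<exists>M :: (nat \<Rightarrow>\<^sub>0 'k::field) pmod. persistence_module pscale n M \<and> pmod_indecomposable pscale n M \<and>
    finite (pmod_support n M)"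
proof -
  interpret glued n "{0}" 0 "\<lambda>_. {\<lambda>_. 0}" "\<lambda>_ _. 0" "{}"
    by unfold_locales (auto simp: grid_def)
  have "finite (pmod_support n (glue_module :: (nat \<Rightarrow>\<^sub>0 'k) pmod))"
    unfolding support_glue_module by simp
  then show ?thesis using persistence_module_glue_module indecomposable_glue_module by blast
qed

theorem theorem7p9:
  fixes n :: nat and b :: "nat \<Rightarrow> nat"
  assumes "n > 0"
  shows "\<exists>M :: (nat \<Rightarrow>\<^sub>0 'k::field) pmod.
    persistence_module pscale n M \<and> pmod_indecomposable pscale n M \<and> finite (pmod_support n M) \<and>
    (\<forall>i. 0 < i \<and> i < n \<longrightarrow> betti TYPE('k) n (pmod_support n M) i = b i)"
proof (cases "n = 1")
  case True
  then show ?thesis using exists_point_module[of n, where 'k='k] by auto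
next
  case False
  \<comment> \<open>Tail sums are antitone, vanish at \<open>n\<close>, and have the
    \<open>b i\<close> as successive differences; \<open>J 1\<close> counts all holes.\<close>
  define J where "J k = (\<Sum>i\<in>{k..<n}. b i)" for k
  interpret configuration n "J 1" J
  proof
    show "2 \<le> n" using assms False by simp
    show "J k \<le> J i" if "i \<le> k" for i k
      unfolding J_def using that by (intro sum_mono2) auto
    show "J n = 0" by (simp add: J_def)
  qed simp
  have J: "J i = b i + J (Suc i)" if "i < n" for i
    using that by (simp add: J_def sum.atLeast_Suc_lessThan)
  have "betti TYPE('k) n total i = b i" if "0 < i" "i < n" for i
    using betti_total[OF that] J[OF that(2)] by simp
  then show ?thesis
    using persistence_module_glue_module indecomposable_glue_module finite_total
        support_total[where 'k='k]
    by (intro exI[of _ "glue_module"]) simp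
qed

end
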